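(* Let $\mathsf{H}$ be a separable complex Hilbert space. The set $$\operatorname{tr}(\cdot)\mathcal{D}_1^{\perp}(\mathsf{P}_c):=\{\operatorname{tr}(\cdot)\mu:\ \mu\in\mathcal{D}_1^{\perp}(\mathsf{P}_c)\}$$ is closed (in $\mathcal{P}(\mathsf{P}_c)$ with the topology of weak convergence). Moreover, for any normal state $\varphi\in\mathcal{S}_n(\mathsf{B}(\mathsf{H}))$, the set $\operatorname{tr}(\cdot)\Lambda_\varphi^{\perp}=\{\operatorname{tr}(\cdot)\mu:\mu\in\Lambda_\varphi^\perp\}$ is compact.
   Context: $\mathsf{P}_c$ is the set of finite rank orthogonal projections of $\mathsf{H}$, with the operator norm topology (equivalently the Hilbert--Schmidt topology); it is a Polish space. $\mathcal{P}(\mathsf{P}_c)$ is the set of Borel probability measures on $\mathsf{P}_c$, with weak convergence in duality with bounded continuous functions $C_b(\mathsf{P}_c)$. $\operatorname{tr}(\cdot)\mu$ denotes the measure with density $P\mapsto\operatorname{tr}(P)$ with respect to $\mu$. Define $\mathcal{D}(\mathsf{P}_c)=\{\mu=\sum_i\lambda_i\delta_{P_i}: P_i\in\mathsf{P}_c,\ \lambda_i\ge0\}$ (countable sums), $\mathcal{D}_1(\mathsf{P}_c)=\{\mu\in\mathcal{D}(\mathsf{P}_c):\operatorname{tr}(\cdot)\mu\in\mathcal{P}(\mathsf{P}_c)\}$, and $\mathcal{D}_1^\perp(\mathsf{P}_c)=\{\mu\in\mathcal{D}_1(\mathsf{P}_c):\operatorname{tr}(PQ)=0\ \text{for all } P\ne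 Q\in\operatorname{supp}(\mu)\}$. $\mathcal{S}_n(\mathsf{B}(\mathsf{H}))$ is the set of normal states $\varphi$ of $\mathsf{B}(\mathsf{H})$; each has a density matrix $\rho_\varphi$ (positive trace class, $\operatorname{tr}\rho_\varphi=1$, $\varphi(B)=\operatorname{tr}(\rho_\varphi B)$). $\Lambda_\varphi^\perp=\{\mu=\sum_i\lambda_i\delta_{P_i}\in\mathcal{D}_1^\perp(\mathsf{P}_c):\sum_i\lambda_iP_i=\rho_\varphi\}$. *)

theory Defs
  imports "HOL-Probability.Probability"
begin

section \<open>Complex Hilbert spaces\<close>

text \<open>The inner product is antilinear in its first and linear in its second argument.\<close>

class complex_hilbert_space = banach +
  fixes scaleC :: "complex \<Rightarrow> 'a \<Rightarrow> 'a" (infixr \<open>*\<^sub>C\<close> 75)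
    and cinner :: "'a \<Rightarrow> 'a \<Rightarrow> complex"
  assumes scaleR_scaleC: "scaleR r x = complex_of_real r *\<^sub>C x"
    and scaleC_add_right: "a *\<^sub>C (x + y) = a *\<^sub>C x + a *\<^sub>C y"
    and scaleC_add_left: "(a + b) *\<^sub>C x = a *\<^sub>C x + b *\<^sub>C x"
    and scaleC_scaleC: "a *\<^sub>C b *\<^sub>C x = (a * b) *\<^sub>C x"
    and scaleC_one: "1 *\<^sub>C x = x"
    and cinner_commute: "cinner x y = cnj (cinner y x)"
    and cinner_add_right: "cinner x (y + z) = cinner x y + cinner x z"
    and cinner_scaleC_right: "cinner x (a *\<^sub>C y) = a * cinner x y"
    and cinner_ge_zero: "cinner x x \<in> \<real>\<^sub>\<ge>\<^sub>0"
    and cinner_eq_zero_iff: "cinner x x = 0 \<longleftrightarrow> x = 0"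
    and norm_eq_sqrt_cinner: "norm x = sqrt (Re (cinner x x))"

global_interpretation complex_vector:
  vector_space "scaleC :: complex \<Rightarrow> 'a \<Rightarrow> 'a :: complex_hilbert_space"
  defines cspan = complex_vector.span
  by unfold_locales
    (simp_all add: scaleC_add_right scaleC_add_left scaleC_scaleC scaleC_one)

lemma norm_scaleC: "norm (a *\<^sub>C x) = cmod a * norm (x :: 'a :: complex_hilbert_space)"
proof -
  have "cinner (a *\<^sub>C x) (a *\<^sub>C x) = a * cnj (cinner x (a *\<^sub>C x))"
    by (metis cinner_commute cinner_scaleC_right)
  also have "\<dots> = (a * cnj a) * cinner x x"
    using cinner_commute[of x x] by (simp add: cinner_scaleC_right)
  also have "a * cnj a = complex_of_real ((cmod a)\<^sup>2)"
    by (rule complex_norm_square[symmetric])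
  finally have "Re (cinner (a *\<^sub>C x) (a *\<^sub>C x)) = (cmod a)\<^sup>2 * Re (cinner x x)"
    by simp
  then show ?thesis
    by (simp add: norm_eq_sqrt_cinner real_sqrt_mult)
qed

definition orthonormal_basis :: "'h::complex_hilbert_space set \<Rightarrow> bool" where
  "orthonormal_basis B \<longleftrightarrow>
     (\<forall>e\<in>B. \<forall>f\<in>B. cinner e f = (if e = f then 1 else 0)) \<and> closure (cspan B) = UNIV"


section \<open>Bounded operators\<close>

text \<open>The elements of the type \<open>'h \<Rightarrow>\<^sub>L 'h\<close> are the bounded real-linear operators, with the
  operator norm; \<open>B(H)\<close> is the set of the complex-linear ones.\<close>

definition BH :: "('h::complex_hilbert_space \<Rightarrow>\<^sub>L 'h) set" where
  "BH = {T. \<forall>c x. blinfun_apply T (c *\<^sub>C x) = c *\<^sub>C blinfun_apply T x}"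

lift_definition scaleC_op ::
  "complex \<Rightarrow> ('h::complex_hilbert_space \<Rightarrow>\<^sub>L 'h) \<Rightarrow> ('h \<Rightarrow>\<^sub>L 'h)"
  is "\<lambda>c T x. c *\<^sub>C T x"
proof -
  fix c and T :: "'h \<Rightarrow> 'h"
  assume T: "bounded_linear T"
  have "bounded_linear (\<lambda>y::'h. c *\<^sub>C y)"
    by (rule bounded_linear_intro[where K = "cmod c"])
      (simp_all add: scaleC_add_right scaleR_scaleC scaleC_scaleC norm_scaleC mult.commute)
  then show "bounded_linear (\<lambda>x. c *\<^sub>C T x)"
    using T by (rule bounded_linear_compose)
qed

definition selfadjoint_op :: "('h::complex_hilbert_space \<Rightarrow>\<^sub>L 'h) \<Rightarrow> bool" where
  "selfadjoint_op T \<longleftrightarrow>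
     T \<in> BH \<and> (\<forall>x y. cinner (blinfun_apply T x) y = cinner x (blinfun_apply T y))"

definition positive_op :: "('h::complex_hilbert_space \<Rightarrow>\<^sub>L 'h) \<Rightarrow> bool" where
  "positive_op T \<longleftrightarrow> T \<in> BH \<and> (\<forall>x. cinner x (blinfun_apply T x) \<in> \<real>\<^sub>\<ge>\<^sub>0)"

definition op_le :: "('h::complex_hilbert_space \<Rightarrow>\<^sub>L 'h) \<Rightarrow> ('h \<Rightarrow>\<^sub>L 'h) \<Rightarrow> bool" where
  "op_le S T \<longleftrightarrow> positive_op (T - S)"

text \<open>The operator \<open>A\<close> below is the absolute value of \<open>T\<close>: it is positive and
  \<open>A\<^sup>2 = T\<^sup>* T\<close>.\<close>

definition trace_class :: "('h::complex_hilbert_space \<Rightarrow>\<^sub>L 'h) \<Rightarrow> bool" where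
  "trace_class T \<longleftrightarrow> T \<in> BH \<and>
     (\<exists>A. positive_op A \<and>
        (\<forall>x y. cinner (blinfun_apply A x) (blinfun_apply A y)
             = cinner (blinfun_apply T x) (blinfun_apply T y)) \<and>
        (\<forall>B. orthonormal_basis B \<longrightarrow> (\<lambda>e. cinner e (blinfun_apply A e)) summable_on B))"

text \<open>On trace class operators, the trace does not depend on the chosen basis.\<close>

definition trace_op :: "('h::complex_hilbert_space \<Rightarrow>\<^sub>L 'h) \<Rightarrow> complex" where
  "trace_op T = (\<Sum>\<^sub>\<infinity>e\<in>(SOME B. orthonormal_basis B). cinner e (blinfun_apply T e))"


section \<open>Normal states\<close>

definition state :: "(('h::complex_hilbert_space \<Rightarrow>\<^sub>L 'h) \<Rightarrow> complex) \<Rightarrow> bool" where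
  "state \<phi> \<longleftrightarrow>
     (\<forall>S\<in>BH. \<forall>T\<in>BH. \<phi> (S + T) = \<phi> S + \<phi> T) \<and>
     (\<forall>c. \<forall>T\<in>BH. \<phi> (scaleC_op c T) = c * \<phi> T) \<and>
     (\<forall>T. positive_op T \<longrightarrow> \<phi> T \<in> \<real>\<^sub>\<ge>\<^sub>0) \<and>
     \<phi> id_blinfun = 1"

text \<open>\<open>is_op_sup A a\<close>: the self-adjoint operator \<open>a\<close> is the least upper bound, among the
  self-adjoint operators, of the nonempty upward directed set \<open>A\<close> of self-adjoint operators.\<close>

definition is_op_sup ::
  "('h::complex_hilbert_space \<Rightarrow>\<^sub>L 'h) set \<Rightarrow> ('h \<Rightarrow>\<^sub>L 'h) \<Rightarrow> bool" where
  "is_op_sup A a \<longleftrightarrow>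
     A \<noteq> {} \<and> (\<forall>S\<in>A. selfadjoint_op S) \<and>
     (\<forall>S\<in>A. \<forall>T\<in>A. \<exists>R\<in>A. op_le S R \<and> op_le T R) \<and>
     selfadjoint_op a \<and> (\<forall>S\<in>A. op_le S a) \<and>
     (\<forall>b. selfadjoint_op b \<longrightarrow> (\<forall>S\<in>A. op_le S b) \<longrightarrow> op_le a b)"

text \<open>Normality is preservation of suprema of bounded increasing nets; a net is replaced by its
  range, and \<open>\<phi>\<close> is real on self-adjoint operators.\<close>

definition normal_states :: "(('h::complex_hilbert_space \<Rightarrow>\<^sub>L 'h) \<Rightarrow> complex) set" where
  "normal_states =
     {\<phi>. state \<phi> \<and> (\<forall>A a. is_op_sup A a \<longrightarrow> Re (\<phi> a) = (SUP S\<in>A. Re (\<phi> S)))}"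

definition density_matrix ::
  "(('h::complex_hilbert_space \<Rightarrow>\<^sub>L 'h) \<Rightarrow> complex) \<Rightarrow> ('h \<Rightarrow>\<^sub>L 'h)" where
  "density_matrix \<phi> =
     (THE \<rho>. positive_op \<rho> \<and> trace_class \<rho> \<and> trace_op \<rho> = 1 \<and>
        (\<forall>B\<in>BH. \<phi> B = trace_op (\<rho> o\<^sub>L B)))"


section \<open>Finite rank projections and measures on them\<close>

text \<open>The zero projection is included.\<close>

definition Pc :: "('h::complex_hilbert_space \<Rightarrow>\<^sub>L 'h) set" where
  "Pc = {P. selfadjoint_op P \<and> P o\<^sub>L P = P \<and>
            (\<exists>F. finite F \<and> range (blinfun_apply P) \<subseteq> cspan F)}"

definition borel_Pc :: "('h::complex_hilbert_space \<Rightarrow>\<^sub>L 'h) measure" where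
  "borel_Pc = restrict_space borel Pc"

definition prob_Pc :: "('h::complex_hilbert_space \<Rightarrow>\<^sub>L 'h) measure set" where
  "prob_Pc = {\<nu>. sets \<nu> = sets borel_Pc \<and> prob_space \<nu>}"

text \<open>The coarsest topology on \<open>prob_Pc\<close> for which integration against each bounded continuous
  function on \<open>Pc\<close> is continuous.\<close>

definition weak_topology :: "('h::complex_hilbert_space \<Rightarrow>\<^sub>L 'h) measure topology" where
  "weak_topology = topology_generated_by
     {{\<nu>\<in>prob_Pc. (\<integral>P. f P \<partial>\<nu>) \<in> U} | (f :: ('h \<Rightarrow>\<^sub>L 'h) \<Rightarrow> real) U.
        continuous_on Pc f \<and> bounded (f ` Pc) \<and> open U}"

text \<open>The measure with density \<open>P \<mapsto> tr(P)\<close> with respect to \<open>\<mu>\<close>.\<close>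

definition tr_measure ::
  "('h::complex_hilbert_space \<Rightarrow>\<^sub>L 'h) measure \<Rightarrow> ('h \<Rightarrow>\<^sub>L 'h) measure" where
  "tr_measure \<mu> = density \<mu> (\<lambda>P. ennreal (Re (trace_op P)))"

text \<open>\<open>is_dirac_rep l P\<close> says that \<open>l\<close> and \<open>P\<close> are admissible data for the countable sum
  \<open>\<Sum>\<^sub>i l\<^sub>i \<delta>\<^bsub>P\<^sub>i\<^esub>\<close>; finite sums are obtained by taking \<open>l\<^sub>i = 0\<close> for large \<open>i\<close>.\<close>

definition is_dirac_rep :: "(nat \<Rightarrow> real) \<Rightarrow> (nat \<Rightarrow> 'h::complex_hilbert_space \<Rightarrow>\<^sub>L 'h) \<Rightarrow> bool" where
  "is_dirac_rep l P \<longleftrightarrow> (\<forall>i. 0 \<le> l i) \<and> (\<forall>i. P i \<in> Pc)"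

definition dirac_sum ::
  "(nat \<Rightarrow> real) \<Rightarrow> (nat \<Rightarrow> 'h::complex_hilbert_space \<Rightarrow>\<^sub>L 'h) \<Rightarrow> ('h \<Rightarrow>\<^sub>L 'h) measure" where
  "dirac_sum l P = measure_of (space borel_Pc) (sets borel_Pc)
     (\<lambda>A. \<Sum>i. ennreal (l i) * emeasure (return borel_Pc (P i)) A)"

lemma sets_dirac_sum [simp]: "sets (dirac_sum l P) = sets borel_Pc"
  by (simp add: dirac_sum_def sets.sigma_sets_eq)

lemma space_borel_Pc: "space borel_Pc = Pc"
  by (simp add: borel_Pc_def space_restrict_space)

lemma space_dirac_sum [simp]: "space (dirac_sum l P) = Pc"
  by (simp add: dirac_sum_def space_measure_of_conv space_borel_Pc)

lemma emeasure_dirac_sum: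
  assumes "A \<in> sets borel_Pc"
  shows "emeasure (dirac_sum l P) A = (\<Sum>i. ennreal (l i) * indicator A (P i))"
proof -
  let ?\<mu> = "\<lambda>A. \<Sum>i. ennreal (l i) * emeasure (return borel_Pc (P i)) A"
  have "emeasure (dirac_sum l P) A = ?\<mu> A"
  proof (rule emeasure_measure_of[OF dirac_sum_def])
    show "sets borel_Pc \<subseteq> Pow (space borel_Pc)" by (rule sets.space_closed)
    show "A \<in> sets (dirac_sum l P)" using assms by simp
    show "positive (sets (dirac_sum l P)) ?\<mu>" by (simp add: positive_def)
    show "countably_additive (sets (dirac_sum l P)) ?\<mu>"
    proof (rule countably_additiveI)
      fix D :: "nat \<Rightarrow> _"
      assume D: "range D \<subseteq> sets (dirac_sum l P)" "disjoint_family D"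
      have "(\<Sum>n. ?\<mu> (D n))
          = (\<Sum>i. \<Sum>n. ennreal (l i) * emeasure (return borel_Pc (P i)) (D n))"
        using nn_integral_suminf[of "\<lambda>i n. ennreal (l i) * emeasure (return borel_Pc (P i)) (D n)"
            "count_space UNIV"]
        by (simp add: nn_integral_count_space_nat)
      also have "\<dots> = ?\<mu> (\<Union>n. D n)"
        using D by (simp add: suminf_indicator)
      finally show "(\<Sum>n. ?\<mu> (D n)) = ?\<mu> (\<Union>n. D n)" .
    qed
  qed
  then show ?thesis using assms by simp
qed

definition discrete_measures :: "('h::complex_hilbert_space \<Rightarrow>\<^sub>L 'h) measure set" where
  "discrete_measures = {\<mu>. \<exists>l P. is_dirac_rep l P \<and> \<mu> = dirac_sum l P}"

definition D1 :: "('h::complex_hilbert_space \<Rightarrow>\<^sub>L 'h) measure set" where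
  "D1 = {\<mu> \<in> discrete_measures. tr_measure \<mu> \<in> prob_Pc}"

definition measure_support :: "'a::topological_space measure \<Rightarrow> 'a set" where
  "measure_support \<mu> =
     {x \<in> space \<mu>. \<forall>U. open U \<and> x \<in> U \<longrightarrow> emeasure \<mu> (U \<inter> space \<mu>) > 0}"

definition D1_perp :: "('h::complex_hilbert_space \<Rightarrow>\<^sub>L 'h) measure set" where
  "D1_perp = {\<mu> \<in> D1. \<forall>P\<in>measure_support \<mu>. \<forall>Q\<in>measure_support \<mu>.
                 P \<noteq> Q \<longrightarrow> trace_op (P o\<^sub>L Q) = 0}"

text \<open>The series converges in operator norm, since \<open>\<Sum>\<^sub>i l\<^sub>i tr(P\<^sub>i) = 1\<close> for \<open>\<mu> \<in> D1\<close>,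
  and its value depends only on \<open>\<mu>\<close>.\<close>

definition Lambda_perp ::
  "(('h::complex_hilbert_space \<Rightarrow>\<^sub>L 'h) \<Rightarrow> complex) \<Rightarrow> ('h \<Rightarrow>\<^sub>L 'h) measure set" where
  "Lambda_perp \<phi> = {\<mu> \<in> D1_perp. \<exists>l P. is_dirac_rep l P \<and> \<mu> = dirac_sum l P \<and>
                      (\<lambda>i. l i *\<^sub>R P i) sums density_matrix \<phi>}"

end

theory Submission
  imports Defs
begin

text \<open>
  Write \<open>tr(\<cdot>)\<mu>\<close> for \<open>tr_measure \<mu>\<close>. Nonzero orthogonal projections have distance at least 1, and
  \<open>Pc\<close> is separable. A probability measure on \<open>Pc\<close> whose support consists of pairwise orthogonal
  nonzero projections is therefore a countable sum of point masses, and dividing each mass by the rank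
  of its projection exhibits it as \<open>tr(\<cdot>)\<mu>\<close> with \<open>\<mu> \<in> D1_perp\<close>. Conversely, every \<open>tr(\<cdot>)\<mu>\<close> with
  \<open>\<mu> \<in> D1_perp\<close> has such a support. This characterisation is \<open>tr_D1_perp_iff\<close> together with
  \<open>ex_orth_rep\<close>.

  Closedness follows, because violating the condition on the support is stable: a measure violates it
  by charging every neighbourhood of 0, or every neighbourhood of \<open>P\<close> and of \<open>Q\<close> for two distinct
  projections with \<open>P o\<^sub>L Q \<noteq> 0\<close>. For small balls, charging them is a weakly open condition that no
  measure in the set meets (\<open>closedin_tr_D1_perp\<close>).

  For compactness let \<open>\<rho>\<close> be the density matrix. The equation \<open>\<Sum>\<^sub>i l\<^sub>i P\<^sub>i = \<rho>\<close> says that the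
  bounded continuous functions \<open>P \<mapsto> Re \<langle>x, P y\<rangle> / tr(P)\<close> have prescribed integrals against
  \<open>tr(\<cdot>)\<mu>\<close>, so the set in question is closed (\<open>closedin_tr_Lambda_perp\<close>), and it is enough to place it
  inside a compact set. The weights \<open>l\<^sub>i\<close> of the distinct atoms are eigenvalues of \<open>\<rho>\<close>, and the atoms
  of weight \<open>a > 0\<close> add up to the projection onto the eigenspace of \<open>a\<close>, which is
  finite-dimensional (\<open>spectral_projection\<close>). Split the mass \<open>l\<^sub>i tr(P\<^sub>i)\<close> of each atom into \<open>tr(P\<^sub>i)\<close>
  parts of size \<open>l\<^sub>i\<close>. Then \<open>tr(\<cdot>)\<mu> = \<Sum>\<^sub>n \<kappa>\<^sub>n \<delta>\<^bsub>T\<^sub>n\<^esub>\<close>, where \<open>\<kappa>\<close> is the list of positive eigenvalues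
  of \<open>\<rho>\<close> with multiplicity, which is the same for all \<open>\<mu>\<close>, and only the \<open>T\<^sub>n\<close> vary: \<open>T\<^sub>n\<close> is a
  projection into the eigenspace of \<open>\<kappa>\<^sub>n\<close>. Such projections form a compact set
  (\<open>compact_subprojections\<close>), their product is compact by Tychonoff's theorem, and \<open>T \<mapsto> \<Sum>\<^sub>n \<kappa>\<^sub>n \<delta>\<^bsub>T\<^sub>n\<^esub>\<close>
  is continuous because \<open>\<Sum>\<^sub>n \<kappa>\<^sub>n = 1\<close> makes the series of integrals converge uniformly
  (\<open>compactin_dirac_sums\<close>).
\<close>


section \<open>Inner product geometry\<close>

lemma cinner_add_left: "cinner (x + y) z = cinner x z + cinner (y :: 'h::complex_hilbert_space) z"
  by (metis cinner_add_right cinner_commute complex_cnj_add)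

lemma cinner_scaleC_left: "cinner (a *\<^sub>C x) y = cnj a * cinner (x :: 'h::complex_hilbert_space) y"
  by (metis cinner_commute cinner_scaleC_right complex_cnj_mult)

lemma cinner_self: "cinner x x = complex_of_real ((norm (x :: 'h::complex_hilbert_space))\<^sup>2)"
proof -
  have "cinner x x = complex_of_real (Re (cinner x x))" "0 \<le> Re (cinner x x)"
    using cinner_ge_zero[of x]
    by (auto simp: complex_nonneg_Reals_iff complex_eq_iff)
  then show ?thesis
    by (metis norm_eq_sqrt_cinner real_sqrt_pow2)
qed

lemma bounded_bilinear_scaleC:
  "bounded_bilinear (scaleC :: complex \<Rightarrow> 'h \<Rightarrow> 'h::complex_hilbert_space)"
proof
  show "\<exists>K. \<forall>a b. norm (a *\<^sub>C (b :: 'h)) \<le> norm a * norm b * K"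
    by (rule exI[of _ 1]) (simp add: norm_scaleC)
qed (simp_all add: scaleC_add_right scaleC_add_left scaleR_scaleC scaleC_scaleC
       scaleR_conv_of_real mult.commute)

interpretation scaleC: bounded_bilinear
  "scaleC :: complex \<Rightarrow> 'h \<Rightarrow> 'h::complex_hilbert_space"
  by (rule bounded_bilinear_scaleC)

lemma additive_cinner_right: "Modules.additive (cinner (x :: 'h::complex_hilbert_space))"
  by standard (rule cinner_add_right)

lemma additive_cinner_left: "Modules.additive (\<lambda>x. cinner x (y :: 'h::complex_hilbert_space))"
  by standard (rule cinner_add_left)

lemma Cauchy_Schwarz_cinner:
  "cmod (cinner x y) \<le> norm x * norm (y :: 'h::complex_hilbert_space)"
proof (cases "y = 0")
  case True
  then show ?thesis by (simp add: Modules.additive.zero[OF additive_cinner_right])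
next
  case False
  define c where "c = cinner y x / cinner y y"
  have n: "cinner y y \<noteq> 0" using False by (simp add: cinner_eq_zero_iff)
  \<comment> \<open>The component of \<open>x\<close> orthogonal to \<open>y\<close> has nonnegative squared length.\<close>
  have "cinner y (x - c *\<^sub>C y) = 0"
    using n by (simp add: Modules.additive.diff[OF additive_cinner_right] cinner_scaleC_right c_def)
  then have "cinner (x - c *\<^sub>C y) (x - c *\<^sub>C y) = cinner x (x - c *\<^sub>C y)"
    by (simp add: Modules.additive.diff[OF additive_cinner_left] cinner_scaleC_left)
  also have "\<dots> = cinner x x - c * cinner x y"
    by (simp add: Modules.additive.diff[OF additive_cinner_right] cinner_scaleC_right)
  also have "c * cinner x y = (cinner x y * cnj (cinner x y)) / cinner y y"
    by (simp add: c_def cinner_commute[of y x])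
  also have "\<dots> = complex_of_real ((cmod (cinner x y))\<^sup>2 / (norm y)\<^sup>2)"
    by (simp add: complex_norm_square[symmetric] cinner_self)
  finally have "complex_of_real ((norm (x - c *\<^sub>C y))\<^sup>2)
      = complex_of_real ((norm x)\<^sup>2 - (cmod (cinner x y))\<^sup>2 / (norm y)\<^sup>2)"
    by (simp add: cinner_self)
  then have "(norm x)\<^sup>2 - (cmod (cinner x y))\<^sup>2 / (norm y)\<^sup>2 \<ge> 0"
    by (metis of_real_eq_iff zero_le_power2)
  then have "(cmod (cinner x y))\<^sup>2 \<le> (norm x * norm y)\<^sup>2"
    using False by (simp add: field_simps)
  then show ?thesis
    by (rule power2_le_imp_le) simp
qed

lemma bounded_bilinear_cinner:
  "bounded_bilinear (cinner :: 'h \<Rightarrow> 'h::complex_hilbert_space \<Rightarrow> complex)"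
proof
  show "\<exists>K. \<forall>a b :: 'h. norm (cinner a b) \<le> norm a * norm b * K"
    by (rule exI[of _ 1]) (simp add: Cauchy_Schwarz_cinner)
qed (simp_all add: cinner_add_right cinner_add_left scaleR_scaleC cinner_scaleC_right
       cinner_scaleC_left scaleR_conv_of_real)

interpretation cinner: bounded_bilinear
  "cinner :: 'h \<Rightarrow> 'h::complex_hilbert_space \<Rightarrow> complex"
  by (rule bounded_bilinear_cinner)

lemma cinner_eqI:
  assumes "\<And>y. cinner y x = cinner y (x' :: 'h::complex_hilbert_space)"
  shows "x = x'"
  using assms[of "x - x'"] cinner_eq_zero_iff[of "x - x'"] by (simp add: cinner.diff_right)

text \<open>The imaginary part of \<open>\<langle>x, T y\<rangle>\<close> is the real part of \<open>\<langle>\<i>x, T y\<rangle>\<close>, so real parts suffice.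
  They are what real-valued test functions on \<open>Pc\<close> can see.\<close>

lemma Re_cinner_eqI:
  fixes S T :: "'h::complex_hilbert_space \<Rightarrow>\<^sub>L 'h"
  assumes "\<And>x y. Re (cinner x (S y)) = Re (cinner x (T y))"
  shows "S = T"
proof (rule blinfun_eqI)
  fix y
  show "S y = T y"
  proof (rule cinner_eqI)
    fix x
    have "Im (cinner x (R y)) = Re (cinner (\<i> *\<^sub>C x) (R y))" for R :: "'h \<Rightarrow>\<^sub>L 'h"
      by (simp add: cinner_scaleC_left)
    then show "cinner x (S y) = cinner x (T y)"
      using assms by (simp add: complex_eq_iff)
  qed
qed

lemma norm_add_orthogonal:
  assumes "cinner x y = 0"
  shows "(norm (x + y :: 'h::complex_hilbert_space))\<^sup>2 = (norm x)\<^sup>2 + (norm y)\<^sup>2"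
proof -
  have "cinner y x = 0" using assms cinner_commute[of y x] by simp
  then have "cinner (x + y) (x + y) = cinner x x + cinner y y"
    using assms by (simp add: cinner.add_left cinner.add_right)
  then show ?thesis
    unfolding cinner_self by (metis of_real_add of_real_eq_iff)
qed


section \<open>Projections\<close>

definition is_proj :: "('h::complex_hilbert_space \<Rightarrow>\<^sub>L 'h) \<Rightarrow> bool" where
  "is_proj P \<longleftrightarrow> selfadjoint_op P \<and> P o\<^sub>L P = P"

lemma is_proj_idem: "is_proj P \<Longrightarrow> P (P x) = P x"
  unfolding is_proj_def by (metis blinfun_apply_blinfun_compose)

lemma is_proj_adj: "is_proj P \<Longrightarrow> cinner (P x) y = cinner x (P y)"
  unfolding is_proj_def selfadjoint_op_def by blast

lemma is_proj_scaleC: "is_proj P \<Longrightarrow> P (c *\<^sub>C x) = c *\<^sub>C P x"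
  unfolding is_proj_def selfadjoint_op_def BH_def by blast

lemma PcD: "P \<in> Pc \<Longrightarrow> is_proj P"
  unfolding Pc_def is_proj_def by blast

lemma is_proj_norm_split:
  assumes "is_proj P"
  shows "(norm x)\<^sup>2 = (norm (P x))\<^sup>2 + (norm (x - P x))\<^sup>2"
proof -
  have "cinner (P x) (x - P x) = 0"
    using assms by (simp add: is_proj_adj cinner.diff_right is_proj_idem blinfun.diff_right)
  from norm_add_orthogonal[OF this] show ?thesis by simp
qed

lemma is_proj_norm_le: "is_proj P \<Longrightarrow> norm (P x) \<le> norm x"
  by (rule power2_le_imp_le) (use is_proj_norm_split[of P x] in auto)

lemma is_proj_compl_norm_le: "is_proj P \<Longrightarrow> norm (x - P x) \<le> norm x"
  by (rule power2_le_imp_le) (use is_proj_norm_split[of P x] in auto)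

lemma is_proj_norm_le_1: "is_proj P \<Longrightarrow> norm P \<le> 1"
  by (rule norm_blinfun_bound) (auto simp: is_proj_norm_le)

lemma is_proj_cinner_self: "is_proj P \<Longrightarrow> cinner x (P x) = complex_of_real ((norm (P x))\<^sup>2)"
  by (metis cinner_self is_proj_adj is_proj_idem)

lemma is_proj_commute:
  assumes "is_proj P" "is_proj Q" "is_proj (P o\<^sub>L Q)"
  shows "P o\<^sub>L Q = Q o\<^sub>L P"
proof (rule blinfun_eqI, rule cinner_eqI)
  fix x y
  have "cinner y ((P o\<^sub>L Q) x) = cinner ((P o\<^sub>L Q) y) x"
    using is_proj_adj[OF assms(3)] by simp
  then show "cinner y ((P o\<^sub>L Q) x) = cinner y ((Q o\<^sub>L P) x)"
    using assms(1,2) by (simp add: is_proj_adj)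
qed

text \<open>The product \<open>P o\<^sub>L Q\<close> is self-adjoint, so it equals its adjoint \<open>Q o\<^sub>L P\<close>.\<close>

lemma is_proj_absorb:
  assumes "is_proj P" "is_proj Q" "P o\<^sub>L Q = Q"
  shows "Q o\<^sub>L P = Q"
  using is_proj_commute[of P Q] assms by simp


section \<open>Orthonormal sets and rank-one operators\<close>

definition orthonormal :: "'h::complex_hilbert_space set \<Rightarrow> bool" where
  "orthonormal F \<longleftrightarrow> (\<forall>e\<in>F. \<forall>f\<in>F. cinner e f = (if e = f then 1 else 0))"

lemma orthonormalD: "orthonormal F \<Longrightarrow> e \<in> F \<Longrightarrow> f \<in> F \<Longrightarrow> cinner e f = (if e = f then 1 else 0)"
  unfolding orthonormal_def by blast

lemma orthonormal_subset: "orthonormal F \<Longrightarrow> G \<subseteq> F \<Longrightarrow> orthonormal G"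
  unfolding orthonormal_def by blast

lift_definition rank_one ::
  "'h::complex_hilbert_space \<Rightarrow> 'h \<Rightarrow> ('h \<Rightarrow>\<^sub>L 'h)"
  is "\<lambda>x y z. cinner y z *\<^sub>C x"
  by (rule bounded_linear_compose[OF scaleC.bounded_linear_left cinner.bounded_linear_right])

lemma bounded_bilinear_rank_one:
  "bounded_bilinear (rank_one :: 'h::complex_hilbert_space \<Rightarrow> 'h \<Rightarrow> ('h \<Rightarrow>\<^sub>L 'h))"
proof
  show "\<exists>K. \<forall>a b :: 'h. norm (rank_one a b) \<le> norm a * norm b * K"
  proof (rule exI[of _ 1], intro allI norm_blinfun_bound)
    fix a b z :: 'h
    show "norm (rank_one a b z) \<le> norm a * norm b * 1 * norm z"
      using mult_right_mono[OF Cauchy_Schwarz_cinner[of b z], of "norm a"]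
      by (simp add: rank_one.rep_eq norm_scaleC mult_ac)
  qed simp
qed (auto intro!: blinfun_eqI simp: rank_one.rep_eq blinfun.add_left blinfun.scaleR_left
       scaleC_add_right cinner.add_left scaleC_add_left cinner.scaleR_left scaleC.scaleR_left
       scaleC.scaleR_right)

interpretation rank_one: bounded_bilinear
  "rank_one :: 'h::complex_hilbert_space \<Rightarrow> 'h \<Rightarrow> ('h \<Rightarrow>\<^sub>L 'h)"
  by (rule bounded_bilinear_rank_one)

definition proj_onto :: "'h::complex_hilbert_space set \<Rightarrow> ('h \<Rightarrow>\<^sub>L 'h)" where
  "proj_onto F = (\<Sum>f\<in>F. rank_one f f)"

lemma proj_onto_apply: "proj_onto F x = (\<Sum>f\<in>F. cinner f x *\<^sub>C f)"
  by (simp add: proj_onto_def blinfun.sum_left rank_one.rep_eq)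

lemma proj_onto_in_span: "proj_onto F x \<in> cspan F"
  unfolding proj_onto_apply
  by (intro complex_vector.span_sum complex_vector.span_scale complex_vector.span_base)

lemma proj_onto_scaleC: "proj_onto F (c *\<^sub>C x) = c *\<^sub>C proj_onto F x"
  by (simp add: proj_onto_apply cinner_scaleC_right scaleC.sum_right scaleC_scaleC)

lemma proj_onto_fix:
  assumes "finite F" "orthonormal F" "x \<in> cspan F"
  shows "proj_onto F x = x"
proof -
  have "cspan F \<subseteq> {x. proj_onto F x = x}"
  proof (rule complex_vector.span_minimal)
    show "F \<subseteq> {x. proj_onto F x = x}"
    proof
      fix e assume e: "e \<in> F"
      have "proj_onto F e = (\<Sum>f\<in>F. if f = e then e else 0)"
        unfolding proj_onto_apply
        by (rule sum.cong) (use e assms(2) in \<open>auto simp: orthonormalD scaleC_one scaleC.zero_left\<close>)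
      then show "e \<in> {x. proj_onto F x = x}" using e assms(1) by simp
    qed
    show "complex_vector.subspace {x. proj_onto F x = x}"
      by (rule complex_vector.subspaceI)
        (auto simp: blinfun.zero_right blinfun.add_right proj_onto_scaleC)
  qed
  then show ?thesis using assms(3) by blast
qed

lemma is_proj_proj_onto:
  assumes "finite F" "orthonormal F"
  shows "is_proj (proj_onto F)"
  unfolding is_proj_def selfadjoint_op_def BH_def
proof (intro conjI allI CollectI blinfun_eqI)
  fix x y
  show "cinner (proj_onto F x) y = cinner x (proj_onto F y)"
    unfolding proj_onto_apply cinner.sum_left cinner.sum_right
    by (rule sum.cong[OF refl])
      (simp add: cinner_scaleC_left cinner_scaleC_right cinner_commute[of x])
  show "(proj_onto F o\<^sub>L proj_onto F) x = proj_onto F x"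
    by (simp add: proj_onto_fix[OF assms] proj_onto_in_span)
qed (rule proj_onto_scaleC)

lemma proj_onto_in_Pc:
  assumes "finite F" "orthonormal F"
  shows "proj_onto F \<in> Pc"
  using is_proj_proj_onto[OF assms] proj_onto_in_span assms(1)
  unfolding Pc_def is_proj_def by blast

text \<open>One step of orthonormalisation: if \<open>d\<close> is not already in the span, add the normalised component
  of \<open>d\<close> orthogonal to it.\<close>

lemma Gram_Schmidt_step:
  assumes "finite F" "orthonormal F"
  obtains F' where "finite F'" "orthonormal F'" "F \<subseteq> F'" "cspan F' = cspan (insert d F)"
proof (cases "d \<in> cspan F")
  case True
  then have "cspan F = cspan (insert d F)"
    by (metis complex_vector.span_redundant)
  then show ?thesis using that[of F] assms by simp
next
  case False
  define r where "r = d - proj_onto F d"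
  define u where "u = complex_of_real (1 / norm r) *\<^sub>C r"
  note pr = is_proj_proj_onto[OF assms]
  have r0: "r \<noteq> 0" using False proj_onto_in_span[of F d] by (auto simp: r_def)
  have fr: "cinner f r = 0" if "f \<in> F" for f
  proof -
    have "proj_onto F r = 0"
      by (simp add: r_def blinfun.diff_right is_proj_idem[OF pr])
    moreover have "proj_onto F f = f"
      using that by (intro proj_onto_fix assms complex_vector.span_base)
    ultimately show ?thesis by (metis is_proj_adj[OF pr] cinner.zero_right)
  qed
  have fu: "cinner f u = 0" "cinner u f = 0" if "f \<in> F" for f
    using fr[OF that] cinner_commute[of r f]
    by (auto simp: u_def cinner_scaleC_right cinner_scaleC_left)
  have uu: "cinner u u = 1"
    using r0 by (simp add: cinner_self u_def norm_scaleC norm_divide)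
  have du: "d = complex_of_real (norm r) *\<^sub>C u + proj_onto F d"
    using r0 by (simp add: u_def scaleC_scaleC scaleC_one r_def)
  show ?thesis
  proof (rule that[of "insert u F"])
    show "orthonormal (insert u F)"
      using assms(2) fu uu unfolding orthonormal_def by fastforce
    have "d \<in> cspan (insert u F)"
      by (subst du, intro complex_vector.span_add complex_vector.span_scale)
        (use proj_onto_in_span[of F d] complex_vector.span_mono[of F "insert u F"]
          in \<open>auto intro: complex_vector.span_base\<close>)
    moreover have "u \<in> cspan (insert d F)"
      unfolding u_def r_def
      by (intro complex_vector.span_diff complex_vector.span_scale)
        (use proj_onto_in_span[of F d] complex_vector.span_mono[of F "insert d F"]
          in \<open>auto intro: complex_vector.span_base\<close>)
    ultimately show "cspan (insert u F) = cspan (insert d F)"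
      unfolding complex_vector.span_eq by (auto intro: complex_vector.span_base)
  qed (use assms in auto)
qed

lemma ex_finite_orthonormal_span:
  assumes "finite G"
  obtains F where "finite F" "orthonormal F" "cspan F = cspan G"
proof -
  have "\<exists>F. finite F \<and> orthonormal F \<and> cspan F = cspan G"
    using assms
  proof (induction G)
    case empty
    show ?case by (rule exI[of _ "{}"]) (simp add: orthonormal_def)
  next
    case (insert d G)
    then obtain F where F: "finite F" "orthonormal F" "cspan F = cspan G" by blast
    obtain F' where "finite F'" "orthonormal F'" "cspan F' = cspan (insert d F)"
      by (rule Gram_Schmidt_step[OF F(1,2), of d])
    moreover have "cspan (insert d F) = cspan (insert d G)"
      using F(3) by (simp add: complex_vector.span_insert)
    ultimately show ?case by auto
  qed
  then show ?thesis using that by blast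
qed

text \<open>The range of \<open>P\<close> is spanned by the image of a finite spanning set, so
  orthonormalising that image gives the vectors sought.\<close>

lemma Pc_proj_onto:
  assumes "P \<in> Pc"
  obtains F where "finite F" "orthonormal F" "P = proj_onto F"
proof -
  obtain G where G: "finite G" "range P \<subseteq> cspan G"
    using assms by (auto simp: Pc_def)
  obtain F where F: "finite F" "orthonormal F" "cspan F = cspan (P ` G)"
    by (rule ex_finite_orthonormal_span[OF finite_imageI[OF G(1)]])
  note pr = PcD[OF assms]
  have "cspan G \<subseteq> {x. P x \<in> cspan F}"
  proof (rule complex_vector.span_minimal)
    show "G \<subseteq> {x. P x \<in> cspan F}"
      unfolding F(3) by (auto intro: complex_vector.span_base)
    show "complex_vector.subspace {x. P x \<in> cspan F}"
      by (rule complex_vector.subspaceI)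
        (auto simp: blinfun.zero_right blinfun.add_right is_proj_scaleC[OF pr]
          complex_vector.span_zero complex_vector.span_add complex_vector.span_scale)
  qed
  then have ran: "P x \<in> cspan F" for x
    using G(2) is_proj_idem[OF pr, of x] by (metis (mono_tags) mem_Collect_eq rangeI subsetD)
  have "cspan F \<subseteq> {x. P x = x}"
    unfolding F(3)
  proof (rule complex_vector.span_minimal)
    show "P ` G \<subseteq> {x. P x = x}" by (auto simp: is_proj_idem[OF pr])
    show "complex_vector.subspace {x. P x = x}"
      by (rule complex_vector.subspaceI)
        (auto simp: blinfun.zero_right blinfun.add_right is_proj_scaleC[OF pr])
  qed
  then have fix_F: "P f = f" if "f \<in> F" for f
    using that complex_vector.span_base[of f F] by blast
  have "P = proj_onto F"
  proof (rule blinfun_eqI)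
    fix x
    have "P x = proj_onto F (P x)"
      by (rule proj_onto_fix[OF F(1,2) ran, symmetric])
    also have "\<dots> = (\<Sum>f\<in>F. cinner (P f) x *\<^sub>C f)"
      unfolding proj_onto_apply by (simp add: is_proj_adj[OF pr])
    also have "\<dots> = proj_onto F x"
      unfolding proj_onto_apply by (intro sum.cong refl) (simp add: fix_F)
    finally show "P x = proj_onto F x" .
  qed
  then show ?thesis using that F by blast
qed


section \<open>Orthonormal bases and the trace\<close>

text \<open>Orthonormalise a dense sequence one vector after the other.\<close>

lemma ex_orthonormal_basis:
  assumes "separable_space (euclidean :: 'h::complex_hilbert_space topology)"
  shows "\<exists>B :: 'h set. orthonormal_basis B"
proof -
  obtain D :: "'h set" where D: "countable D" "closure D = UNIV"
    using assms by (auto simp: separable_space_def)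
  have "D \<noteq> {}" using D(2) by auto
  define d where "d = from_nat_into D"
  have "\<exists>S. \<forall>n. (finite (S n) \<and> orthonormal (S n)) \<and> S n \<subseteq> S (Suc n) \<and> d n \<in> cspan (S (Suc n))"
  proof (rule dependent_nat_choice)
    show "\<exists>x. finite x \<and> orthonormal (x :: 'h set)"
      by (rule exI[of _ "{}"]) (simp add: orthonormal_def)
    fix x :: "'h set" and n assume x: "finite x \<and> orthonormal x"
    show "\<exists>y. (finite y \<and> orthonormal y) \<and> x \<subseteq> y \<and> d n \<in> cspan y"
    proof -
      obtain y where "finite y" "orthonormal y" "x \<subseteq> y" "cspan y = cspan (insert (d n) x)"
        using Gram_Schmidt_step[of x "d n"] x by metis
      then show ?thesis using complex_vector.span_base[of "d n" "insert (d n) x"] by auto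
    qed
  qed
  then obtain S where S: "\<And>n. finite (S n)" "\<And>n. orthonormal (S n)" "\<And>n. S n \<subseteq> S (Suc n)"
      "\<And>n. d n \<in> cspan (S (Suc n))" by blast
  have mono: "S m \<subseteq> S n" if "m \<le> n" for m n
    using lift_Suc_mono_le[of S, OF S(3) that] .
  let ?B = "\<Union>n. S n"
  have "orthonormal ?B"
    unfolding orthonormal_def
  proof safe
    fix e f m n assume "e \<in> S m" "f \<in> S n"
    then have "e \<in> S (max m n)" "f \<in> S (max m n)"
      using mono[of m "max m n"] mono[of n "max m n"] by auto
    then show "cinner e f = (if e = f then 1 else 0)" using S(2) orthonormalD by blast
  qed
  moreover have "D \<subseteq> cspan ?B"
  proof
    fix x assume "x \<in> D"
    then obtain n where "x = d n"
      unfolding d_def using D(1) by (metis from_nat_into_surj)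
    then show "x \<in> cspan ?B"
      using S(4)[of n] complex_vector.span_mono[of "S (Suc n)" ?B] by blast
  qed
  then have "closure (cspan ?B) = UNIV"
    using closure_mono D(2) by blast
  ultimately show ?thesis
    unfolding orthonormal_basis_def orthonormal_def by blast
qed

text \<open>The finite partial sums are best approximations of \<open>x\<close> from finite-dimensional spans, and the
  span of \<open>B\<close> is dense.\<close>

lemma orthonormal_basis_has_sum:
  assumes B: "orthonormal_basis B"
  shows "((\<lambda>e. cinner e x *\<^sub>C e) has_sum x) B"
  unfolding has_sum_def tendsto_iff eventually_finite_subsets_at_top
proof (intro allI impI)
  fix \<epsilon> :: real assume "0 < \<epsilon>"
  have on: "orthonormal B" and "closure (cspan B) = UNIV"
    using B by (auto simp: orthonormal_basis_def orthonormal_def)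
  then obtain z where z: "z \<in> cspan B" "dist z x < \<epsilon>"
    using \<open>0 < \<epsilon>\<close> by (metis UNIV_I closure_approachable)
  obtain F0 where F0: "finite F0" "F0 \<subseteq> B" "z \<in> cspan F0"
  proof -
    obtain t r where t: "finite t" "t \<subseteq> B" "z = (\<Sum>a\<in>t. r a *\<^sub>C a)"
      using z(1) unfolding complex_vector.span_explicit by blast
    then have "z \<in> cspan t"
      by (auto intro!: complex_vector.span_sum complex_vector.span_scale
          intro: complex_vector.span_base)
    then show ?thesis using that t by blast
  qed
  show "\<exists>X. finite X \<and> X \<subseteq> B \<and>
      (\<forall>Y. finite Y \<and> X \<subseteq> Y \<and> Y \<subseteq> B \<longrightarrow> dist (\<Sum>e\<in>Y. cinner e x *\<^sub>C e) x < \<epsilon>)"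
  proof (intro exI[of _ F0] conjI allI impI F0)
    fix Y assume Y: "finite Y \<and> F0 \<subseteq> Y \<and> Y \<subseteq> B"
    have onY: "orthonormal Y" using on Y orthonormal_subset by blast
    have "proj_onto Y z = z"
      using Y F0(3) complex_vector.span_mono[of F0 Y] by (intro proj_onto_fix onY) auto
    \<comment> \<open>The vector \<open>z\<close> lies in the span of \<open>Y\<close>, so subtracting it changes nothing.\<close>
    then have "x - proj_onto Y x = (x - z) - proj_onto Y (x - z)"
      by (simp add: blinfun.diff_right)
    also have "norm \<dots> \<le> norm (x - z)"
      using Y onY by (intro is_proj_compl_norm_le is_proj_proj_onto) auto
    finally show "dist (\<Sum>e\<in>Y. cinner e x *\<^sub>C e) x < \<epsilon>"
      using z(2) by (simp add: proj_onto_apply dist_norm norm_minus_commute)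
  qed
qed

lemma Parseval:
  assumes "orthonormal_basis B"
  shows "((\<lambda>e. cinner e x * cinner y e) has_sum cinner y x) B"
  using has_sum_bounded_linear[OF cinner.bounded_linear_right orthonormal_basis_has_sum[OF assms]]
  by (simp add: o_def cinner_scaleC_right)

lemma has_sum_finite_sum:
  fixes f :: "'i \<Rightarrow> 'a \<Rightarrow> 'b::topological_comm_monoid_add"
  assumes "finite I" "\<And>i. i \<in> I \<Longrightarrow> (f i has_sum s i) A"
  shows "((\<lambda>x. \<Sum>i\<in>I. f i x) has_sum (\<Sum>i\<in>I. s i)) A"
  using assms by (induction I) (simp_all add: has_sum_add has_sum_0)

text \<open>Expanding \<open>proj_onto F\<close> turns the diagonal sum of \<open>T o\<^sub>L proj_onto F\<close> over \<open>B\<close> into finitely many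
  Parseval sums, one for each \<open>f \<in> F\<close>; its value is therefore the same for every basis \<open>B\<close>.\<close>

lemma trace_op_proj_onto_has_sum:
  assumes "orthonormal_basis B" "T \<in> BH"
  shows "((\<lambda>e. cinner e ((T o\<^sub>L proj_onto F) e)) has_sum (\<Sum>f\<in>F. cinner f (T f))) B"
proof (cases "finite F")
  case True
  have "((\<lambda>e. \<Sum>f\<in>F. cinner e (T f) * cinner f e) has_sum (\<Sum>f\<in>F. cinner f (T f))) B"
    by (intro has_sum_finite_sum Parseval assms(1) True)
  moreover have "(\<Sum>f\<in>F. cinner e (T f) * cinner f e) = cinner e ((T o\<^sub>L proj_onto F) e)" for e
    using assms(2)
    by (simp add: proj_onto_apply blinfun.sum_right cinner.sum_right BH_def cinner_scaleC_right
        mult.commute)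
  ultimately show ?thesis by simp
qed (simp add: proj_onto_def cinner.zero_right has_sum_0)


section \<open>Rank\<close>

definition rk :: "('h::complex_hilbert_space \<Rightarrow>\<^sub>L 'h) \<Rightarrow> nat" where
  "rk P = complex_vector.dim (range P)"

lemma independent_orthonormal:
  assumes "finite F" "orthonormal F"
  shows "complex_vector.independent F"
proof
  assume "complex_vector.dependent F"
  then obtain a where a: "a \<in> F" "a \<in> cspan (F - {a})"
    unfolding complex_vector.dependent_def by blast
  have "a = proj_onto (F - {a}) a"
    by (rule proj_onto_fix[symmetric])
      (use assms a(2) in \<open>auto intro: orthonormal_subset\<close>)
  also have "\<dots> = 0"
    unfolding proj_onto_apply
    by (rule sum.neutral) (use a(1) assms(2) in \<open>auto simp: orthonormalD scaleC.zero_left\<close>)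
  finally show False using orthonormalD[OF assms(2) a(1) a(1)] by (simp add: cinner.zero_left)
qed

lemma rk_proj_onto:
  assumes "finite F" "orthonormal F"
  shows "rk (proj_onto F) = card F"
proof -
  have "range (proj_onto F) = cspan F"
    using proj_onto_in_span[of F] proj_onto_fix[OF assms] by (metis image_subset_iff rangeI subsetI subset_antisym)
  then show ?thesis
    using independent_orthonormal[OF assms]
    by (simp add: rk_def complex_vector.dim_eq_card_independent)
qed

lemma zero_in_Pc: "(0 :: 'h::complex_hilbert_space \<Rightarrow>\<^sub>L 'h) \<in> Pc"
  using proj_onto_in_Pc[of "{}"] by (simp add: proj_onto_def orthonormal_def)

lemma rk_eq_0_iff:
  assumes "P \<in> Pc"
  shows "rk P = 0 \<longleftrightarrow> P = 0"
proof -
  obtain F where F: "finite F" "orthonormal F" "P = proj_onto F"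
    using Pc_proj_onto[OF assms] by blast
  show ?thesis
  proof
    assume "P = 0"
    have "F = {}"
    proof (rule ccontr)
      assume "F \<noteq> {}"
      then obtain f where f: "f \<in> F" by blast
      then have "f = P f"
        unfolding F(3) by (intro proj_onto_fix[symmetric] F complex_vector.span_base)
      with \<open>P = 0\<close> show False
        using orthonormalD[OF F(2) f f] by (simp add: cinner.zero_left)
    qed
    then show "rk P = 0" using rk_proj_onto[OF F(1,2)] F(3) by simp
  next
    assume "rk P = 0"
    then have "F = {}" using rk_proj_onto[OF F(1,2)] F by simp
    then show "P = 0" using F by (simp add: proj_onto_def)
  qed
qed

lemma rk_ge_1: "P \<in> Pc \<Longrightarrow> P \<noteq> 0 \<Longrightarrow> 1 \<le> real (rk P)"
  using rk_eq_0_iff[of P] by linarith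

text \<open>The union of orthonormal bases of the two ranges is an orthonormal basis of the range of
  \<open>P + Q\<close>.\<close>

lemma Pc_add_orthogonal:
  assumes "P \<in> Pc" "Q \<in> Pc" "P o\<^sub>L Q = 0"
  shows "P + Q \<in> Pc" "rk (P + Q) = rk P + rk Q"
proof -
  obtain F where F: "finite F" "orthonormal F" "P = proj_onto F"
    using Pc_proj_onto[OF assms(1)] by blast
  obtain G where G: "finite G" "orthonormal G" "Q = proj_onto G"
    using Pc_proj_onto[OF assms(2)] by blast
  have fg: "cinner f g = 0" if "f \<in> F" "g \<in> G" for f g
  proof -
    have "f = P f" unfolding F(3)
      by (intro proj_onto_fix[symmetric] F complex_vector.span_base that)
    moreover have "g = Q g" unfolding G(3)
      by (intro proj_onto_fix[symmetric] G complex_vector.span_base that)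
    moreover have "P (Q g) = 0"
      using assms(3) by (metis blinfun.zero_left blinfun_apply_blinfun_compose)
    ultimately show ?thesis
      by (metis PcD[OF assms(1)] is_proj_adj cinner.zero_right)
  qed
  have gf: "cinner g f = 0" if "f \<in> F" "g \<in> G" for f g
    using fg[OF that] cinner_commute[of g f] by simp
  have disj: "F \<inter> G = {}"
    using fg orthonormalD[OF F(2)] by (metis disjoint_iff one_neq_zero)
  have on: "orthonormal (F \<union> G)"
    unfolding orthonormal_def
    using F(2) G(2) fg gf disj by (auto simp: orthonormalD)
  have eq: "P + Q = proj_onto (F \<union> G)"
    using F G disj by (simp add: proj_onto_def sum.union_disjoint)
  show "P + Q \<in> Pc"
    unfolding eq by (rule proj_onto_in_Pc) (use F G on in auto)
  show "rk (P + Q) = rk P + rk Q"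
  proof -
    have "rk (P + Q) = card (F \<union> G)"
      unfolding eq by (rule rk_proj_onto) (use F G on in auto)
    then show ?thesis
      using rk_proj_onto[OF F(1,2)] rk_proj_onto[OF G(1,2)] F G disj
      by (simp add: card_Un_disjoint)
  qed
qed

lemma Pc_sum_orthogonal:
  assumes "finite J" "\<And>j. j \<in> J \<Longrightarrow> P j \<in> Pc"
    "\<And>i j. i \<in> J \<Longrightarrow> j \<in> J \<Longrightarrow> i \<noteq> j \<Longrightarrow> P i o\<^sub>L P j = 0"
  shows "(\<Sum>j\<in>J. P j) \<in> Pc \<and> rk (\<Sum>j\<in>J. P j) = (\<Sum>j\<in>J. rk (P j))"
  using assms
proof (induction J)
  case empty
  then show ?case using zero_in_Pc rk_eq_0_iff by auto
next
  case (insert i J)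
  have "P i o\<^sub>L (\<Sum>j\<in>J. P j) = (\<Sum>j\<in>J. P i o\<^sub>L P j)"
    by (intro blinfun_eqI) (simp add: blinfun.sum_left blinfun.sum_right)
  also have "\<dots> = 0"
    using insert.hyps insert.prems by (intro sum.neutral) auto
  finally have 0: "P i o\<^sub>L (\<Sum>j\<in>J. P j) = 0" .
  have IH: "(\<Sum>j\<in>J. P j) \<in> Pc" "rk (\<Sum>j\<in>J. P j) = (\<Sum>j\<in>J. rk (P j))"
    using insert.IH insert.prems by auto
  show ?case
    using Pc_add_orthogonal[OF _ IH(1) 0] IH(2) insert.hyps insert.prems by simp
qed

text \<open>The projection \<open>P\<close> is injective on the range of \<open>Q\<close>: a vector there that \<open>P\<close> kills is fixed by
  \<open>Q - P\<close>, which is a strict contraction.\<close>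

lemma rk_le_of_norm_diff_less_1:
  assumes "P \<in> Pc" "Q \<in> Pc" "norm (P - Q) < 1"
  shows "rk Q \<le> rk P"
proof -
  obtain F where F: "finite F" "orthonormal F" "P = proj_onto F"
    using Pc_proj_onto[OF assms(1)] by blast
  obtain G where G: "finite G" "orthonormal G" "Q = proj_onto G"
    using Pc_proj_onto[OF assms(2)] by blast
  interpret vector_space_pair
    "scaleC :: complex \<Rightarrow> 'a \<Rightarrow> 'a" "scaleC :: complex \<Rightarrow> 'a \<Rightarrow> 'a"
    by unfold_locales
  have zero: "x = y" if "x \<in> cspan G" "y \<in> cspan G" "P x = P y" for x y
  proof (rule ccontr)
    assume "x \<noteq> y"
    have "Q (x - y) = x - y"
      unfolding G(3) by (intro proj_onto_fix G complex_vector.span_diff that)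
    moreover have "P (x - y) = 0"
      using that(3) by (simp add: blinfun.diff_right)
    ultimately have "(P - Q) (x - y) = - (x - y)"
      by (simp only: blinfun.diff_left diff_0)
    then have "norm (x - y) \<le> norm (P - Q) * norm (x - y)"
      by (metis norm_blinfun norm_minus_cancel)
    with \<open>x \<noteq> y\<close> assms(3) show False
      using mult_strict_right_mono[of "norm (P - Q)" 1 "norm (x - y)"] by simp
  qed
  have lin: "Vector_Spaces.linear scaleC scaleC (blinfun_apply P)"
    unfolding Vector_Spaces.linear_iff
    by (auto simp: blinfun.add_right is_proj_scaleC[OF PcD[OF assms(1)]]
        intro: complex_vector.vector_space_axioms)
  have inj: "inj_on P (cspan G)" using zero by (rule inj_onI)
  have ind: "complex_vector.independent (P ` G)"
    using linear_independent_injective_image[OF lin independent_orthonormal[OF G(1,2)]] inj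
    by (simp add: cspan_def)
  have "P ` G \<subseteq> cspan F" unfolding F(3) using proj_onto_in_span by blast
  then have "card (P ` G) \<le> card F"
    using complex_vector.independent_span_bound[OF F(1) ind] by blast
  moreover have "card (P ` G) = card G"
    using inj complex_vector.span_superset
    by (intro card_image) (rule inj_on_subset)
  ultimately show ?thesis
    using rk_proj_onto[OF F(1,2)] rk_proj_onto[OF G(1,2)] F G by simp
qed

lemma rk_locally_constant:
  assumes "P \<in> Pc" "Q \<in> Pc" "dist P Q < 1"
  shows "rk P = rk Q"
  using rk_le_of_norm_diff_less_1[of P Q] rk_le_of_norm_diff_less_1[of Q P] assms
  by (simp add: dist_norm norm_minus_commute)

lemma continuous_on_rk: "continuous_on Pc (\<lambda>P. real (rk P))"
  unfolding continuous_on_iff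
proof (intro ballI allI impI)
  fix P :: "'a \<Rightarrow>\<^sub>L 'a" and e :: real assume "P \<in> Pc" "0 < e"
  then show "\<exists>d>0. \<forall>Q\<in>Pc. dist Q P < d \<longrightarrow> dist (real (rk Q)) (real (rk P)) < e"
    by (intro exI[of _ 1]) (auto dest: rk_locally_constant)
qed

text \<open>The operator \<open>P - Q\<close> acts as the identity on the range of \<open>P\<close>. With \<open>Q = 0\<close> this says that the
  zero projection is isolated in \<open>Pc\<close>.\<close>

lemma norm_diff_orthogonal_ge_1:
  assumes "is_proj P" "P \<noteq> 0" "Q o\<^sub>L P = 0"
  shows "1 \<le> norm (P - Q)"
proof -
  obtain x where x: "P x \<noteq> 0"
    using assms(2) by (metis blinfun_eqI blinfun.zero_left)
  have "Q (P x) = 0"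
    using assms(3) by (metis blinfun.zero_left blinfun_apply_blinfun_compose)
  then have "(P - Q) (P x) = P x"
    by (simp add: blinfun.diff_left is_proj_idem[OF assms(1)])
  then have "norm (P x) \<le> norm (P - Q) * norm (P x)"
    by (metis norm_blinfun)
  with x show ?thesis by simp
qed


section \<open>Traces of projections\<close>

lemma trace_op_compose_proj_onto:
  assumes "separable_space (euclidean :: 'h::complex_hilbert_space topology)"
    "(T :: 'h \<Rightarrow>\<^sub>L 'h) \<in> BH"
  shows "trace_op (T o\<^sub>L proj_onto F) = (\<Sum>f\<in>F. cinner f (T f))"
proof -
  have "orthonormal_basis (SOME B :: 'h set. orthonormal_basis B)"
    by (rule someI_ex) (rule ex_orthonormal_basis[OF assms(1)])
  from trace_op_proj_onto_has_sum[OF this assms(2)] show ?thesis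
    unfolding trace_op_def by (rule infsumI)
qed

lemma trace_op_Pc:
  assumes "separable_space (euclidean :: 'h::complex_hilbert_space topology)"
    "(P :: 'h \<Rightarrow>\<^sub>L 'h) \<in> Pc"
  shows "trace_op P = of_nat (rk P)"
proof -
  obtain F where F: "finite F" "orthonormal F" "P = proj_onto F"
    using Pc_proj_onto[OF assms(2)] by blast
  have "trace_op (id_blinfun o\<^sub>L P) = (\<Sum>f\<in>F. cinner f f)"
    using trace_op_compose_proj_onto[OF assms(1), of id_blinfun F] F(3) by (simp add: BH_def)
  also have "\<dots> = of_nat (card F)"
    using orthonormalD[OF F(2)] by simp
  finally show ?thesis
    using rk_proj_onto[OF F(1,2)] F(3) blinfun_eqI[of "id_blinfun o\<^sub>L P" P] by simp
qed

text \<open>If \<open>G\<close> is an orthonormal basis of the range of \<open>Q\<close>, the trace of \<open>P o\<^sub>L Q\<close> is the sum of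
  \<open>(norm (P g))\<^sup>2\<close> over \<open>g \<in> G\<close>, and a sum of nonnegative terms vanishes only if every term
  does.\<close>

lemma trace_op_eq_0_iff:
  assumes "separable_space (euclidean :: 'h::complex_hilbert_space topology)"
    "(P :: 'h \<Rightarrow>\<^sub>L 'h) \<in> Pc" "Q \<in> Pc"
  shows "trace_op (P o\<^sub>L Q) = 0 \<longleftrightarrow> P o\<^sub>L Q = 0"
proof
  obtain G where G: "finite G" "orthonormal G" "Q = proj_onto G"
    using Pc_proj_onto[OF assms(3)] by blast
  note pr = PcD[OF assms(2)]
  have PB: "P \<in> BH" using pr by (simp add: is_proj_def selfadjoint_op_def)
  have "trace_op (P o\<^sub>L Q) = (\<Sum>g\<in>G. complex_of_real ((norm (P g))\<^sup>2))"
    using trace_op_compose_proj_onto[OF assms(1) PB, of G]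
    by (simp add: G(3) is_proj_cinner_self[OF pr])
  also have "\<dots> = complex_of_real (\<Sum>g\<in>G. (norm (P g))\<^sup>2)" by simp
  finally have tr: "trace_op (P o\<^sub>L Q) = complex_of_real (\<Sum>g\<in>G. (norm (P g))\<^sup>2)" .
  show "P o\<^sub>L Q = 0" if "trace_op (P o\<^sub>L Q) = 0"
  proof (rule blinfun_eqI)
    fix x
    have "(\<Sum>g\<in>G. (norm (P g))\<^sup>2) = 0" using tr that by (metis of_real_eq_0_iff)
    then have "\<forall>g\<in>G. P g = 0" using G(1) by (simp add: sum_nonneg_eq_0_iff)
    then show "(P o\<^sub>L Q) x = (0 :: 'h \<Rightarrow>\<^sub>L 'h) x"
      by (simp add: G(3) proj_onto_apply blinfun.sum_right is_proj_scaleC[OF pr] scaleC.zero_right)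
  qed
qed (simp add: trace_op_def cinner.zero_right)


section \<open>Separability of the space of finite rank projections\<close>

text \<open>Finite sums of rank-one operators built from a countable dense set of vectors approximate every
  finite rank projection.\<close>

lemma Pc_separable:
  assumes "separable_space (euclidean :: 'h::complex_hilbert_space topology)"
  obtains C :: "('h::complex_hilbert_space \<Rightarrow>\<^sub>L 'h) set" where "countable C" "Pc \<subseteq> closure C"
proof -
  obtain D :: "'h set" where D: "countable D" "closure D = UNIV"
    using assms by (auto simp: separable_space_def)
  \<comment> \<open>Lists rather than sets index the sums, so that adding sums is concatenation.\<close>
  define op where "op zs = (\<Sum>(x, y)\<leftarrow>zs. rank_one x y)" for zs :: "('h \<times> 'h) list"
  define C where "C = op ` lists (D \<times> D)"
  have add: "S + T \<in> C" if "S \<in> C" "T \<in> C" for S T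
  proof -
    obtain u v where "u \<in> lists (D \<times> D)" "v \<in> lists (D \<times> D)" "S = op u" "T = op v"
      using \<open>S \<in> C\<close> \<open>T \<in> C\<close> unfolding C_def by blast
    then have "S + T = op (u @ v)" "u @ v \<in> lists (D \<times> D)" by (auto simp: op_def)
    then show ?thesis unfolding C_def by blast
  qed
  have rank_one: "rank_one x y \<in> closure C" for x y
  proof -
    have "x \<in> closure D" "y \<in> closure D" using D(2) by auto
    then obtain u v where uv: "\<forall>n. u n \<in> D" "u \<longlonglongrightarrow> x" "\<forall>n. v n \<in> D" "v \<longlonglongrightarrow> y"
      unfolding closure_sequential by blast
    have "rank_one (u n) (v n) \<in> C" for n
    proof -
      have "rank_one (u n) (v n) = op [(u n, v n)]" by (simp add: op_def)
      then show ?thesis unfolding C_def using uv by auto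
    qed
    moreover have "(\<lambda>n. rank_one (u n) (v n)) \<longlonglongrightarrow> rank_one x y"
      by (intro rank_one.tendsto uv)
    ultimately show ?thesis
      unfolding closure_sequential by (intro exI[of _ "\<lambda>n. rank_one (u n) (v n)"]) simp
  qed
  have add_closure: "S + T \<in> closure C" if "S \<in> closure C" "T \<in> closure C" for S T
  proof -
    obtain u v where uv: "\<forall>n. u n \<in> C" "u \<longlonglongrightarrow> S" "\<forall>n. v n \<in> C" "v \<longlonglongrightarrow> T"
      using \<open>S \<in> closure C\<close> \<open>T \<in> closure C\<close> unfolding closure_sequential by blast
    then have "(\<lambda>n. u n + v n) \<longlonglongrightarrow> S + T" "\<forall>n. u n + v n \<in> C"
      by (auto intro: tendsto_add add)
    then show ?thesis unfolding closure_sequential by (intro exI[of _ "\<lambda>n. u n + v n"]) simp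
  qed
  have zero: "0 \<in> closure C"
    using rank_one[of 0 0] by (simp add: rank_one.zero_left)
  have sum: "(\<Sum>f\<in>F. rank_one f f) \<in> closure C" if "finite F" for F
    using that by (induction F) (auto intro: zero add_closure rank_one)
  show ?thesis
  proof (rule that)
    show "countable C"
      unfolding C_def using D(1) by (intro countable_image countable_lists countable_SIGMA)
    show "Pc \<subseteq> closure C"
    proof
      fix P :: "'h \<Rightarrow>\<^sub>L 'h" assume "P \<in> Pc"
      then obtain F where "finite F" "P = proj_onto F" using Pc_proj_onto by metis
      then show "P \<in> closure C" using sum by (simp add: proj_onto_def)
    qed
  qed
qed


section \<open>Countable sums of Dirac measures\<close>

text \<open>A sum of Dirac measures is the image of a weighted counting measure on the indices, so integrals
  against it become series.\<close>

lemma dirac_sum_eq_distr: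
  assumes "\<And>i. P i \<in> Pc"
  shows "dirac_sum l P = distr (density (count_space UNIV) (\<lambda>i. ennreal (l i))) borel_Pc P"
proof (rule measure_eqI)
  fix A assume "A \<in> sets (dirac_sum l P)"
  then have A: "A \<in> sets borel_Pc" by simp
  have "emeasure (distr (density (count_space UNIV) (\<lambda>i. ennreal (l i))) borel_Pc P) A
      = (\<integral>\<^sup>+i. ennreal (l i) * indicator (P -` A) i \<partial>count_space UNIV)"
    using assms A by (subst emeasure_distr) (auto simp: space_borel_Pc emeasure_density)
  also have "\<dots> = (\<Sum>i. ennreal (l i) * indicator A (P i))"
    by (simp add: nn_integral_count_space_nat indicator_vimage[unfolded comp_def])
  finally show "emeasure (dirac_sum l P) A
      = emeasure (distr (density (count_space UNIV) (\<lambda>i. ennreal (l i))) borel_Pc P) A"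
    using emeasure_dirac_sum[OF A] by simp
qed simp

lemma dirac_sum_cong:
  assumes "\<And>i. 0 \<le> w i" "\<And>i. 0 < w i \<Longrightarrow> P i = P' i"
  shows "dirac_sum w P = dirac_sum w P'"
proof (rule measure_eqI)
  fix A assume "A \<in> sets (dirac_sum w P)"
  then have A: "A \<in> sets borel_Pc" by simp
  have "ennreal (w i) * indicator A (P i) = ennreal (w i) * indicator A (P' i)" for i
    using assms(1)[of i] assms(2)[of i] by (cases "w i = 0") auto
  then show "emeasure (dirac_sum w P) A = emeasure (dirac_sum w P') A"
    using emeasure_dirac_sum[OF A] by simp
qed simp

lemma dirac_sum_in_prob_Pc_iff:
  assumes "\<And>i. 0 \<le> w i" "\<And>i. P i \<in> Pc"
  shows "dirac_sum w P \<in> prob_Pc \<longleftrightarrow> w sums 1"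
proof -
  have "emeasure (dirac_sum w P) (space (dirac_sum w P)) = (\<Sum>i. ennreal (w i))"
    using assms(2) emeasure_dirac_sum[of Pc w P] sets.top[of borel_Pc]
    by (simp add: space_borel_Pc)
  moreover have "(\<Sum>i. ennreal (w i)) = 1 \<longleftrightarrow> w sums 1"
  proof
    assume 1: "(\<Sum>i. ennreal (w i)) = 1"
    then have "summable w" using assms(1) by (intro summable_suminf_not_top) auto
    then show "w sums 1"
      using 1 suminf_ennreal2[OF assms(1)] by (simp add: ennreal_eq_1 sums_iff)
  qed (use suminf_ennreal_eq[OF assms(1)] in auto)
  ultimately show ?thesis
    by (auto simp: prob_Pc_def intro: prob_spaceI dest: prob_space.emeasure_space_1)
qed

lemma integral_dirac_sum:
  fixes f :: "('h::complex_hilbert_space \<Rightarrow>\<^sub>L 'h) \<Rightarrow> real"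
  assumes w: "\<And>i. 0 \<le> w i" "w sums 1" and P: "\<And>i. P i \<in> Pc"
    and f: "continuous_on Pc f" "\<And>Q. Q \<in> Pc \<Longrightarrow> \<bar>f Q\<bar> \<le> K"
  shows "(\<lambda>i. w i * f (P i)) sums (\<integral>Q. f Q \<partial>dirac_sum w P)"
proof -
  have fm: "f \<in> borel_measurable borel_Pc"
    unfolding borel_Pc_def by (rule borel_measurable_continuous_on_restrict[OF f(1)])
  have "(\<integral>Q. f Q \<partial>dirac_sum w P) = (\<integral>i. w i * f (P i) \<partial>count_space UNIV)"
    unfolding dirac_sum_eq_distr[OF P]
    using P fm w by (subst integral_distr) (auto simp: space_borel_Pc integral_density)
  moreover have "summable (\<lambda>i. norm (w i * f (P i)))"
  proof (rule summable_comparison_test')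
    show "summable (\<lambda>i. w i * K)" using w(2) by (intro summable_mult2) (auto simp: sums_iff)
    show "norm (norm (w i * f (P i))) \<le> w i * K" for i
      using w(1)[of i] f(2)[OF P[of i]] by (simp add: abs_mult mult_left_mono)
  qed
  ultimately show ?thesis
    using sums_integral_count_space_nat[of "\<lambda>i. w i * f (P i)"]
    by (simp add: integrable_count_space_nat_iff)
qed

lemma sets_borel_Pc_Int_open: "open U \<Longrightarrow> U \<inter> Pc \<in> sets borel_Pc"
  by (auto simp: borel_Pc_def sets_restrict_space Int_commute)

lemma atom_in_measure_support:
  assumes "0 < l i" "P i \<in> Pc"
  shows "P i \<in> measure_support (dirac_sum l P)"
  unfolding measure_support_def
proof (safe, unfold space_dirac_sum)
  show "P i \<in> Pc" by fact
  fix U :: "('a \<Rightarrow>\<^sub>L 'a) set" assume U: "open U" "P i \<in> U"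
  have "0 < ennreal (l i)" using assms(1) by simp
  also have "ennreal (l i) = (\<Sum>j\<in>{i}. ennreal (l j) * indicator (U \<inter> Pc) (P j))"
    using U assms(2) by simp
  also have "\<dots> \<le> (\<Sum>j. ennreal (l j) * indicator (U \<inter> Pc) (P j))"
    by (rule sum_le_suminf) auto
  finally show "0 < emeasure (dirac_sum l P) (U \<inter> Pc)"
    using emeasure_dirac_sum[OF sets_borel_Pc_Int_open[OF U(1)]] by simp
qed

lemma atom_in_of_emeasure_pos:
  assumes "open U" "0 < emeasure (dirac_sum l P) (U \<inter> Pc)" "\<And>i. 0 \<le> l i"
  obtains i where "0 < l i" "P i \<in> U"
proof (rule ccontr)
  assume "\<not> thesis"
  then have "\<not> 0 < l i \<or> P i \<notin> U" for i using that by blast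
  then have z: "ennreal (l i) * indicator (U \<inter> Pc) (P i) = 0" for i
    using assms(3)[of i] by (cases "l i = 0") (auto simp: less_le indicator_def)
  have "emeasure (dirac_sum l P) (U \<inter> Pc) = 0"
    unfolding emeasure_dirac_sum[OF sets_borel_Pc_Int_open[OF assms(1)]] z by simp
  then show False using assms(2) by simp
qed

lemma tr_measure_dirac_sum:
  fixes P :: "nat \<Rightarrow> 'h::complex_hilbert_space \<Rightarrow>\<^sub>L 'h"
  assumes sep: "separable_space (euclidean :: 'h topology)" and rep: "is_dirac_rep l P"
  shows "tr_measure (dirac_sum l P) = dirac_sum (\<lambda>i. l i * rk (P i)) P"
proof (rule measure_eqI)
  have P: "\<And>i. P i \<in> Pc" and l: "\<And>i. 0 \<le> l i"
    using rep by (auto simp: is_dirac_rep_def)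
  have trk: "Re (trace_op Q) = real (rk Q)" if "Q \<in> Pc" for Q :: "'h \<Rightarrow>\<^sub>L 'h"
    using trace_op_Pc[OF sep that] by simp
  have "continuous_on Pc (\<lambda>Q :: 'h \<Rightarrow>\<^sub>L 'h. Re (trace_op Q))"
    using continuous_on_rk trk by (metis (no_types, lifting) continuous_on_cong)
  then have m: "(\<lambda>Q :: 'h \<Rightarrow>\<^sub>L 'h. Re (trace_op Q)) \<in> borel_measurable borel_Pc"
    unfolding borel_Pc_def by (rule borel_measurable_continuous_on_restrict)
  fix A assume "A \<in> sets (tr_measure (dirac_sum l P))"
  then have A: "A \<in> sets borel_Pc" by (simp add: tr_measure_def)
  have m': "(\<lambda>Q. ennreal (Re (trace_op Q)) * indicator A Q) \<in> borel_measurable borel_Pc"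
    using m A by measurable
  have Pm: "P \<in> density (count_space UNIV) (\<lambda>i. ennreal (l i)) \<rightarrow>\<^sub>M borel_Pc"
    using P by (simp add: space_borel_Pc)
  have "emeasure (tr_measure (dirac_sum l P)) A
      = (\<integral>\<^sup>+Q. ennreal (Re (trace_op Q)) * indicator A Q \<partial>dirac_sum l P)"
    unfolding tr_measure_def using A m
    by (subst emeasure_density) (auto simp: measurable_cong_sets[OF sets_dirac_sum refl])
  also have "\<dots> = (\<integral>\<^sup>+i. ennreal (l i) * (ennreal (Re (trace_op (P i))) * indicator A (P i))
      \<partial>count_space UNIV)"
    unfolding dirac_sum_eq_distr[OF P] using m'
    by (subst nn_integral_distr[OF Pm]) (auto simp: nn_integral_density)
  also have "\<dots> = (\<Sum>i. ennreal (l i * rk (P i)) * indicator A (P i))"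
    by (simp add: nn_integral_count_space_nat trk[OF P] ennreal_mult l mult.assoc)
  also have "\<dots> = emeasure (dirac_sum (\<lambda>i. l i * rk (P i)) P) A"
    using emeasure_dirac_sum[OF A] by simp
  finally show "emeasure (tr_measure (dirac_sum l P)) A
      = emeasure (dirac_sum (\<lambda>i. l i * rk (P i)) P) A" .
qed (simp add: tr_measure_def)


section \<open>Orthogonal representations\<close>

text \<open>Being distinct and having a nonzero product are open conditions on a pair of operators. This is
  what makes orthogonality of the atoms survive limits, both of points of the support and of
  measures.\<close>

lemma nonorthogonal_pairs_open:
  fixes P Q :: "'h::complex_hilbert_space \<Rightarrow>\<^sub>L 'h"
  assumes "P \<noteq> Q" "P o\<^sub>L Q \<noteq> 0"
  obtains e where "0 < e"
    "\<And>P' Q'. P' \<in> ball P e \<Longrightarrow> Q' \<in> ball Q e \<Longrightarrow> P' \<noteq> Q' \<and> P' o\<^sub>L Q' \<noteq> 0"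
proof -
  let ?O = "{z :: ('h \<Rightarrow>\<^sub>L 'h) \<times> ('h \<Rightarrow>\<^sub>L 'h). fst z \<noteq> snd z} \<inter> {z. fst z o\<^sub>L snd z \<noteq> 0}"
  have "open ?O"
    by (intro open_Int open_Collect_neq continuous_intros
        bounded_bilinear.continuous_on[OF bounded_bilinear_blinfun_compose])
  moreover have "(P, Q) \<in> ?O" using assms by simp
  ultimately obtain A B where AB: "open A" "open B" "(P, Q) \<in> A \<times> B" "A \<times> B \<subseteq> ?O"
    by (rule open_prod_elim)
  obtain a where a: "0 < a" "ball P a \<subseteq> A"
    using AB(1,3) by (auto simp: open_contains_ball)
  obtain b where b: "0 < b" "ball Q b \<subseteq> B"
    using AB(2,3) by (auto simp: open_contains_ball)
  show ?thesis
  proof (rule that[of "min a b"])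
    fix P' Q' assume "P' \<in> ball P (min a b)" "Q' \<in> ball Q (min a b)"
    then have "P' \<in> A" "Q' \<in> B" using a b by auto
    then have "(P', Q') \<in> ?O" using AB(4) by blast
    then show "P' \<noteq> Q' \<and> P' o\<^sub>L Q' \<noteq> 0" by simp
  qed (use a b in simp)
qed

text \<open>Every neighbourhood of a point of the support contains an atom, so two distinct points with
  nonzero product would be approximated by two distinct atoms with nonzero product.\<close>

lemma measure_support_orthogonal:
  assumes l: "\<And>i. 0 \<le> l i"
    and orth: "\<And>i j. 0 < l i \<Longrightarrow> 0 < l j \<Longrightarrow> P i \<noteq> P j \<Longrightarrow> P i o\<^sub>L P j = 0"
    and XY: "X \<in> measure_support (dirac_sum l P)" "Y \<in> measure_support (dirac_sum l P)" "X \<noteq> Y"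
  shows "X o\<^sub>L Y = 0"
proof (rule ccontr)
  assume "X o\<^sub>L Y \<noteq> 0"
  then obtain e where e: "0 < e"
    "\<And>P' Q'. P' \<in> ball X e \<Longrightarrow> Q' \<in> ball Y e \<Longrightarrow> P' \<noteq> Q' \<and> P' o\<^sub>L Q' \<noteq> 0"
    using nonorthogonal_pairs_open[OF XY(3)] by metis
  have pos: "0 < emeasure (dirac_sum l P) (ball Z e \<inter> Pc)"
    if "Z \<in> measure_support (dirac_sum l P)" for Z
    using that e(1) unfolding measure_support_def space_dirac_sum by auto
  obtain i where i: "0 < l i" "P i \<in> ball X e"
    using atom_in_of_emeasure_pos[OF open_ball pos[OF XY(1)] l] by blast
  obtain j where j: "0 < l j" "P j \<in> ball Y e"
    using atom_in_of_emeasure_pos[OF open_ball pos[OF XY(2)] l] by blast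
  show False using e(2)[OF i(2) j(2)] orth i(1) j(1) by blast
qed

text \<open>Orthogonality is imposed on the support, which may contain limits of atoms. It can be checked on
  the atoms, and there it means vanishing products rather than vanishing traces of products.\<close>

lemma D1_perp_iff:
  fixes \<mu> :: "('h::complex_hilbert_space \<Rightarrow>\<^sub>L 'h) measure"
  assumes sep: "separable_space (euclidean :: 'h topology)"
  shows "\<mu> \<in> D1_perp \<longleftrightarrow> (\<exists>l P. is_dirac_rep l P \<and> \<mu> = dirac_sum l P \<and>
      (\<lambda>i. l i * rk (P i)) sums 1 \<and>
      (\<forall>i j. 0 < l i \<longrightarrow> 0 < l j \<longrightarrow> P i \<noteq> P j \<longrightarrow> P i o\<^sub>L P j = 0))"
    (is "_ \<longleftrightarrow> (\<exists>l P. ?R l P)")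
proof
  assume \<mu>: "\<mu> \<in> D1_perp"
  then obtain l P where rep: "is_dirac_rep l P" "\<mu> = dirac_sum l P"
    by (auto simp: D1_perp_def D1_def discrete_measures_def)
  have P: "\<And>i. P i \<in> Pc" and l: "\<And>i. 0 \<le> l i"
    using rep(1) by (auto simp: is_dirac_rep_def)
  have "dirac_sum (\<lambda>i. l i * rk (P i)) P \<in> prob_Pc"
    using \<mu> tr_measure_dirac_sum[OF sep rep(1)] rep(2) by (simp add: D1_perp_def D1_def)
  then have "(\<lambda>i. l i * rk (P i)) sums 1"
    using dirac_sum_in_prob_Pc_iff[of "\<lambda>i. l i * rk (P i)" P] l P by simp
  moreover have "P i o\<^sub>L P j = 0" if "0 < l i" "0 < l j" "P i \<noteq> P j" for i j
  proof -
    have "trace_op (P i o\<^sub>L P j) = 0"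
      using \<mu> that atom_in_measure_support[of l _ P] P
      unfolding D1_perp_def rep(2) by blast
    then show ?thesis using trace_op_eq_0_iff[OF sep P P] by blast
  qed
  ultimately show "\<exists>l P. ?R l P" using rep by blast
next
  assume "\<exists>l P. ?R l P"
  then obtain l P where R: "?R l P" by blast
  then have P: "\<And>i. P i \<in> Pc" and l: "\<And>i. 0 \<le> l i" and \<mu>: "\<mu> = dirac_sum l P"
    by (auto simp: is_dirac_rep_def)
  have "\<mu> \<in> D1"
    using R tr_measure_dirac_sum[OF sep, of l P] l P
      dirac_sum_in_prob_Pc_iff[of "\<lambda>i. l i * rk (P i)" P]
    by (auto simp: D1_def discrete_measures_def)
  moreover have "X o\<^sub>L Y = 0"
    if "X \<in> measure_support \<mu>" "Y \<in> measure_support \<mu>" "X \<noteq> Y" for X Y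
    using measure_support_orthogonal[of l P X Y] that R l \<mu> by blast
  then have "trace_op (X o\<^sub>L Y) = 0"
    if XY: "X \<in> measure_support \<mu>" "Y \<in> measure_support \<mu>" "X \<noteq> Y" for X Y
    using that by (simp add: trace_op_def cinner.zero_right)
  ultimately show "\<mu> \<in> D1_perp" by (simp add: D1_perp_def)
qed

text \<open>A normal form for \<open>tr(\<cdot>)\<mu>\<close>: atoms of positive weight with different indices are different,
  so \<open>w i\<close> is the whole mass at \<open>P i\<close>. The projections are nonzero even where \<open>w i = 0\<close>, so that
  dividing by their rank is harmless.\<close>

definition orth_rep ::
  "(nat \<Rightarrow> real) \<Rightarrow> (nat \<Rightarrow> 'h::complex_hilbert_space \<Rightarrow>\<^sub>L 'h) \<Rightarrow> bool" where
  "orth_rep w P \<longleftrightarrow> (\<forall>i. 0 \<le> w i) \<and> w sums 1 \<and> (\<forall>i. P i \<in> Pc \<and> P i \<noteq> 0) \<and>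
     (\<forall>i j. i \<noteq> j \<longrightarrow> 0 < w i \<longrightarrow> 0 < w j \<longrightarrow> P i o\<^sub>L P j = 0)"

lemma tr_measure_of_orth_rep:
  fixes P :: "nat \<Rightarrow> 'h::complex_hilbert_space \<Rightarrow>\<^sub>L 'h"
  assumes sep: "separable_space (euclidean :: 'h topology)" and w: "orth_rep w P"
  defines "l \<equiv> \<lambda>i. w i / rk (P i)"
  shows "is_dirac_rep l P" "(\<lambda>i. l i * rk (P i)) = w" "dirac_sum l P \<in> D1_perp"
    "tr_measure (dirac_sum l P) = dirac_sum w P"
proof -
  have rk: "0 < rk (P i)" for i
    using w rk_eq_0_iff[of "P i"] by (auto simp: orth_rep_def)
  show rep: "is_dirac_rep l P"
    using w by (simp add: is_dirac_rep_def l_def orth_rep_def)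
  show eq: "(\<lambda>i. l i * rk (P i)) = w"
    using rk by (auto simp: l_def fun_eq_iff)
  then show "tr_measure (dirac_sum l P) = dirac_sum w P"
    using tr_measure_dirac_sum[OF sep rep] by simp
  have pos: "0 < l i \<longleftrightarrow> 0 < w i" for i
    using rk[of i] by (simp add: l_def zero_less_divide_iff)
  show "dirac_sum l P \<in> D1_perp"
    unfolding D1_perp_iff[OF sep]
  proof (intro exI[of _ l] exI[of _ P] conjI allI impI)
    show "(\<lambda>i. l i * rk (P i)) sums 1" unfolding eq using w by (simp add: orth_rep_def)
    fix i j assume "0 < l i" "0 < l j" "P i \<noteq> P j"
    then show "P i o\<^sub>L P j = 0" using w unfolding pos orth_rep_def by metis
  qed (simp_all add: rep)
qed

text \<open>The complement of the support is covered by the null balls with centre in a countable dense set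
  and rational radius.\<close>

lemma compl_measure_support_null:
  fixes \<nu> :: "('h::complex_hilbert_space \<Rightarrow>\<^sub>L 'h) measure"
  assumes sep: "separable_space (euclidean :: 'h topology)" and \<nu>: "\<nu> \<in> prob_Pc"
  obtains Z where "Z \<in> null_sets \<nu>" "Pc - measure_support \<nu> \<subseteq> Z"
proof -
  have sets: "sets \<nu> = sets borel_Pc" using \<nu> by (simp add: prob_Pc_def)
  then have sp: "space \<nu> = Pc" by (metis sets_eq_imp_space_eq space_borel_Pc)
  obtain C :: "('h \<Rightarrow>\<^sub>L 'h) set" where C: "countable C" "Pc \<subseteq> closure C"
    using Pc_separable[OF sep] by blast
  define I where "I = {(c, r). c \<in> C \<and> r \<in> \<rat> \<and> emeasure \<nu> (ball c r \<inter> Pc) = 0}"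
  let ?Z = "\<Union>(c, r)\<in>I. ball c r \<inter> Pc"
  have "countable I"
    by (rule countable_subset[of _ "C \<times> \<rat>"]) (auto simp: I_def C countable_rat)
  then have "?Z \<in> null_sets \<nu>"
    by (rule null_sets_UN') (auto simp: I_def sets sets_borel_Pc_Int_open intro!: null_setsI)
  moreover have "Pc - measure_support \<nu> \<subseteq> ?Z"
  proof
    fix x assume x: "x \<in> Pc - measure_support \<nu>"
    then obtain U where U: "open U" "x \<in> U" "emeasure \<nu> (U \<inter> Pc) = 0"
      by (auto simp: measure_support_def sp)
    obtain e where e: "0 < e" "ball x e \<subseteq> U" using U by (auto simp: open_contains_ball)
    obtain r where r: "r \<in> \<rat>" "0 < r" "r < e / 2"
      using Rats_dense_in_real[of 0 "e / 2"] e by auto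
    obtain c where c: "c \<in> C" "dist c x < r"
      using C(2) x r(2) closure_approachable[of x C] by blast
    have "ball c r \<subseteq> U"
    proof
      fix y assume "y \<in> ball c r"
      then have "dist x y < e"
        using c(2) r(3) dist_triangle[of x y c] by (simp add: dist_commute)
      then show "y \<in> U" using e(2) by auto
    qed
    then have "emeasure \<nu> (ball c r \<inter> Pc) \<le> emeasure \<nu> (U \<inter> Pc)"
      by (intro emeasure_mono) (auto simp: sets sets_borel_Pc_Int_open U)
    then have "(c, r) \<in> I" using U(3) c r by (simp add: I_def)
    moreover have "x \<in> ball c r \<inter> Pc" using c(2) x by simp
    ultimately show "x \<in> ?Z" by blast
  qed
  ultimately show ?thesis using that by blast
qed

text \<open>Orthogonal nonzero projections have distance at least 1, so by separability there are only
  countably many in an orthogonal family.\<close>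

lemma countable_orthogonal_Pc:
  fixes S :: "('h::complex_hilbert_space \<Rightarrow>\<^sub>L 'h) set"
  assumes sep: "separable_space (euclidean :: 'h topology)"
    and S: "S \<subseteq> Pc" "0 \<notin> S" "\<And>P Q. P \<in> S \<Longrightarrow> Q \<in> S \<Longrightarrow> P \<noteq> Q \<Longrightarrow> P o\<^sub>L Q = 0"
  shows "countable S"
proof -
  obtain C :: "('h \<Rightarrow>\<^sub>L 'h) set" where C: "countable C" "Pc \<subseteq> closure C"
    using Pc_separable[OF sep] by blast
  have "\<forall>P\<in>S. \<exists>c\<in>C. dist c P < 1/2"
  proof
    fix P assume "P \<in> S"
    then have "P \<in> closure C" using C(2) S(1) by blast
    then show "\<exists>c\<in>C. dist c P < 1/2"
      using closure_approachable[of P C] by (auto dest!: spec[of _ "1/2"])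
  qed
  then obtain g where g: "\<And>P. P \<in> S \<Longrightarrow> g P \<in> C \<and> dist (g P) P < 1/2" by metis
  have "inj_on g S"
  proof (rule inj_onI, rule ccontr)
    fix P Q assume PQ: "P \<in> S" "Q \<in> S" "g P = g Q" "P \<noteq> Q"
    have "1 \<le> norm (P - Q)"
      using PQ S by (intro norm_diff_orthogonal_ge_1) (auto intro: PcD)
    moreover have "dist P Q < 1"
      using g[OF PQ(1)] g[OF PQ(2)] PQ(3) dist_triangle[of P Q "g P"]
      by (simp add: dist_commute)
    ultimately show False by (simp add: dist_norm)
  qed
  moreover have "countable (g ` S)"
    using g C(1) by (intro countable_subset[of "g ` S" C]) auto
  ultimately show ?thesis by (rule countable_image_inj_on[rotated])
qed

text \<open>The support is countable and carries the whole mass, so the measure is the sum of its point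
  masses.\<close>

lemma ex_orth_rep:
  fixes \<nu> :: "('h::complex_hilbert_space \<Rightarrow>\<^sub>L 'h) measure"
  assumes sep: "separable_space (euclidean :: 'h topology)" and \<nu>: "\<nu> \<in> prob_Pc"
    and nz: "0 \<notin> measure_support \<nu>"
    and orth: "\<And>P Q. P \<in> measure_support \<nu> \<Longrightarrow> Q \<in> measure_support \<nu> \<Longrightarrow> P \<noteq> Q \<Longrightarrow> P o\<^sub>L Q = 0"
  obtains w P where "orth_rep w P" "\<nu> = dirac_sum w P"
proof -
  define S where "S = measure_support \<nu>"
  have sets: "sets \<nu> = sets borel_Pc" and "prob_space \<nu>" using \<nu> by (simp_all add: prob_Pc_def)
  interpret prob_space \<nu> by fact
  have sp: "space \<nu> = Pc" using sets by (metis sets_eq_imp_space_eq space_borel_Pc)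
  have SPc: "S \<subseteq> Pc" by (auto simp: S_def measure_support_def sp)
  have cS: "countable S"
    using countable_orthogonal_Pc[OF sep SPc] nz orth by (auto simp: S_def)
  have single: "{x} \<in> sets \<nu>" if "x \<in> Pc" for x
    using that by (auto simp: sets borel_Pc_def sets_restrict_space intro!: image_eqI[of _ _ "{x}"])
  have Ssub: "T \<in> sets \<nu>" if "T \<subseteq> S" for T
  proof (rule sets.countable)
    show "countable T" using countable_subset[OF that cS] .
    show "{x} \<in> sets \<nu>" if "x \<in> T" for x
      using single that \<open>T \<subseteq> S\<close> SPc by blast
  qed
  obtain Z where Z: "Z \<in> null_sets \<nu>" "Pc - S \<subseteq> Z"
    using compl_measure_support_null[OF sep \<nu>] S_def by blast
  have on_S: "emeasure \<nu> A = emeasure \<nu> (A \<inter> S)" if "A \<in> sets \<nu>" for A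
  proof (rule emeasure_eq_AE)
    show "AE x in \<nu>. x \<in> A \<longleftrightarrow> x \<in> A \<inter> S"
      using Z(1) by (rule AE_I') (use Z(2) sp in auto)
  qed (use that Ssub in auto)
  have Sne: "S \<noteq> {}"
    using on_S[OF sets.top] emeasure_space_1 by auto
  define P where "P = from_nat_into S"
  define I where "I = to_nat_on S ` S"
  \<comment> \<open>If the support is finite, the enumeration \<open>P\<close> repeats its members; only the indices in \<open>I\<close>
    carry weight, so that each member is counted once.\<close>
  define w where "w i = (if i \<in> I then measure \<nu> {P i} else 0)" for i
  have PS: "P i \<in> S" for i unfolding P_def using Sne by (rule from_nat_into)
  have P: "P i \<in> Pc" "P i \<noteq> 0" for i
    using PS[of i] SPc nz by (auto simp: S_def)
  have bij: "bij_betw P I S"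
    by (rule bij_betw_byWitness[where f' = "to_nat_on S"])
      (auto simp: I_def P_def cS from_nat_into Sne)
  have eq: "\<nu> = dirac_sum w P"
  proof (rule measure_eqI)
    fix A assume A: "A \<in> sets \<nu>"
    have "emeasure \<nu> (A \<inter> S) = (\<integral>\<^sup>+x. emeasure \<nu> {x} \<partial>count_space (A \<inter> S))"
      using cS single SPc by (intro emeasure_countable_singleton) auto
    also have "\<dots> = (\<integral>\<^sup>+x. emeasure \<nu> {x} * indicator A x \<partial>count_space S)"
      by (auto simp: nn_integral_count_space_indicator indicator_inter_arith mult_ac
          intro!: nn_integral_cong split: split_indicator)
    also have "\<dots> = (\<integral>\<^sup>+i. emeasure \<nu> {P i} * indicator A (P i) \<partial>count_space I)"
      by (rule nn_integral_bij_count_space[OF bij, symmetric])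
    also have "\<dots> = (\<integral>\<^sup>+i. ennreal (w i) * indicator A (P i) \<partial>count_space UNIV)"
      by (auto simp: nn_integral_count_space_indicator w_def emeasure_eq_measure
          intro!: nn_integral_cong split: split_indicator)
    also have "\<dots> = emeasure (dirac_sum w P) A"
      using A emeasure_dirac_sum[of A w P] by (simp add: nn_integral_count_space_nat sets)
    finally show "emeasure \<nu> A = emeasure (dirac_sum w P) A" using on_S[OF A] by simp
  qed (simp add: sets)
  have w0: "0 \<le> w i" for i by (simp add: w_def)
  have "w sums 1"
    using dirac_sum_in_prob_Pc_iff[of w P] w0 P(1) \<nu> eq by simp
  moreover have "P i o\<^sub>L P j = 0" if "i \<noteq> j" "0 < w i" "0 < w j" for i j
  proof -
    have "i \<in> I" "j \<in> I" using that by (auto simp: w_def split: if_splits)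
    then have "P i \<noteq> P j" using bij that(1) by (auto simp: bij_betw_def inj_on_def)
    then show ?thesis using orth[of "P i" "P j"] PS by (simp add: S_def)
  qed
  ultimately have "orth_rep w P" using P w0 by (simp add: orth_rep_def)
  then show ?thesis using eq that by blast
qed


section \<open>Closedness in the weak topology\<close>

lemma openin_weak_topology_integral:
  fixes f :: "('h::complex_hilbert_space \<Rightarrow>\<^sub>L 'h) \<Rightarrow> real"
  assumes "continuous_on Pc f" "bounded (f ` Pc)" "open U"
  shows "openin weak_topology {\<nu>\<in>prob_Pc. (\<integral>P. f P \<partial>\<nu>) \<in> U}"
  unfolding weak_topology_def by (rule topology_generated_by_Basis) (use assms in blast)

lemma topspace_weak_topology: "topspace weak_topology = prob_Pc"
proof
  show "topspace weak_topology \<subseteq> prob_Pc"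
    unfolding weak_topology_def topology_generated_by_topspace by blast
  show "prob_Pc \<subseteq> topspace weak_topology"
    using openin_subset[OF openin_weak_topology_integral[of "\<lambda>_. 0" UNIV]]
    by (simp add: finite_imp_bounded image_constant_conv)
qed

lemma prob_PcD:
  assumes "\<nu> \<in> prob_Pc"
  shows "prob_space \<nu>" "sets \<nu> = sets borel_Pc" "space \<nu> = Pc"
  using assms sets_eq_imp_space_eq[of \<nu> borel_Pc] by (auto simp: prob_Pc_def space_borel_Pc)

lemma integrable_prob_Pc:
  fixes f :: "('h::complex_hilbert_space \<Rightarrow>\<^sub>L 'h) \<Rightarrow> real"
  assumes "\<nu> \<in> prob_Pc" "continuous_on Pc f" "\<And>Q. Q \<in> Pc \<Longrightarrow> \<bar>f Q\<bar> \<le> K"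
  shows "integrable \<nu> f"
proof -
  interpret prob_space \<nu> by (rule prob_PcD[OF assms(1)])
  have "f \<in> borel_measurable borel_Pc"
    unfolding borel_Pc_def by (rule borel_measurable_continuous_on_restrict[OF assms(2)])
  then have "f \<in> borel_measurable \<nu>"
    by (simp add: measurable_cong_sets[OF prob_PcD(2)[OF assms(1)] refl])
  then show ?thesis
    by (intro integrable_const_bound[where B = K] AE_I2) (auto simp: prob_PcD[OF assms(1)] assms(3))
qed

text \<open>A measure charges the ball iff the tent function over that ball, which is bounded and
  continuous, has positive integral.\<close>

lemma openin_weak_topology_ball:
  fixes P :: "'h::complex_hilbert_space \<Rightarrow>\<^sub>L 'h"
  assumes "0 < e"
  shows "openin weak_topology {\<nu>\<in>prob_Pc. 0 < emeasure \<nu> (ball P e \<inter> Pc)}"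
proof -
  define f where "f Q = max 0 (e - dist P Q)" for Q
  have cont: "continuous_on Pc f"
    unfolding f_def by (intro continuous_intros)
  have bd: "\<bar>f Q\<bar> \<le> e" for Q using assms by (simp add: f_def)
  have "0 < emeasure \<nu> (ball P e \<inter> Pc) \<longleftrightarrow> 0 < (\<integral>Q. f Q \<partial>\<nu>)" if \<nu>: "\<nu> \<in> prob_Pc" for \<nu>
  proof -
    have int: "integrable \<nu> f" using integrable_prob_Pc[OF \<nu> cont bd] .
    have nn: "AE Q in \<nu>. 0 \<le> f Q" by (simp add: f_def)
    have "{Q \<in> space \<nu>. f Q \<noteq> 0} = ball P e \<inter> Pc"
      by (auto simp: prob_PcD[OF \<nu>] f_def max_def)
    then have "(AE Q in \<nu>. f Q = 0) \<longleftrightarrow> emeasure \<nu> (ball P e \<inter> Pc) = 0"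
      by (intro AE_iff_measurable) (simp_all add: prob_PcD[OF \<nu>] sets_borel_Pc_Int_open)
    then have "(\<integral>Q. f Q \<partial>\<nu>) = 0 \<longleftrightarrow> emeasure \<nu> (ball P e \<inter> Pc) = 0"
      using integral_nonneg_eq_0_iff_AE[OF int nn] by simp
    moreover have "0 \<le> (\<integral>Q. f Q \<partial>\<nu>)" by (rule integral_nonneg_AE[OF nn])
    ultimately show ?thesis by (auto simp: less_le zero_less_iff_neq_zero)
  qed
  then have "{\<nu>\<in>prob_Pc. 0 < emeasure \<nu> (ball P e \<inter> Pc)}
      = {\<nu>\<in>prob_Pc. (\<integral>Q. f Q \<partial>\<nu>) \<in> {0<..}}" by auto
  moreover have "bounded (f ` Pc)"
    using bd by (intro boundedI[where B = e]) auto
  ultimately show ?thesis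
    using openin_weak_topology_integral[OF cont, of "{0<..}"] by simp
qed

text \<open>The unit ball around 0 contains no nonzero projection.\<close>

lemma dirac_sum_unit_ball_null:
  assumes "\<And>i. 0 \<le> l i" "\<And>i. P i \<in> Pc" "\<And>i. 0 < l i \<Longrightarrow> P i \<noteq> 0"
  shows "emeasure (dirac_sum l P) (ball 0 1 \<inter> Pc) = 0"
proof (rule ccontr)
  assume "emeasure (dirac_sum l P) (ball 0 1 \<inter> Pc) \<noteq> 0"
  then obtain i where i: "0 < l i" "P i \<in> ball 0 1"
    using atom_in_of_emeasure_pos[of "ball 0 1" l P] assms(1)
    by (metis open_ball zero_less_iff_neq_zero)
  have "1 \<le> norm (P i - 0)"
    using assms i by (intro norm_diff_orthogonal_ge_1) (auto intro: PcD)
  then show False using i(2) by simp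
qed

text \<open>Passing from an arbitrary representation to the support of \<open>\<nu>\<close> merges repeated atoms and discards
  the zero projection, which \<open>tr(\<cdot>)\<mu>\<close> does not charge.\<close>

lemma tr_D1_perp_iff:
  fixes \<nu> :: "('h::complex_hilbert_space \<Rightarrow>\<^sub>L 'h) measure"
  assumes sep: "separable_space (euclidean :: 'h topology)"
  shows "\<nu> \<in> tr_measure ` D1_perp \<longleftrightarrow> (\<exists>w P. orth_rep w P \<and> \<nu> = dirac_sum w P)"
proof
  assume "\<nu> \<in> tr_measure ` D1_perp"
  then obtain \<mu> where \<mu>: "\<mu> \<in> D1_perp" "\<nu> = tr_measure \<mu>" by blast
  then obtain l P where R: "is_dirac_rep l P" "\<mu> = dirac_sum l P"
      "\<And>i j. 0 < l i \<Longrightarrow> 0 < l j \<Longrightarrow> P i \<noteq> P j \<Longrightarrow> P i o\<^sub>L P j = 0"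
    unfolding D1_perp_iff[OF sep] by blast
  define w where "w i = l i * rk (P i)" for i
  have P: "\<And>i. P i \<in> Pc" and l: "\<And>i. 0 \<le> l i"
    using R(1) by (auto simp: is_dirac_rep_def)
  have w: "0 \<le> w i" for i using l by (simp add: w_def)
  have \<nu>: "\<nu> = dirac_sum w P"
    using tr_measure_dirac_sum[OF sep R(1)] \<mu>(2) R(2) by (simp add: w_def[abs_def])
  have wl: "0 < w i \<Longrightarrow> 0 < l i \<and> P i \<noteq> 0" for i
    using l[of i] rk_eq_0_iff[OF P, of i] by (auto simp: w_def zero_less_mult_iff)
  have "0 \<notin> measure_support \<nu>"
  proof
    assume "0 \<in> measure_support \<nu>"
    then have "0 < emeasure \<nu> (ball 0 1 \<inter> Pc)"
      by (auto simp: measure_support_def \<nu>)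
    then show False
      using dirac_sum_unit_ball_null[of w P, OF w P] wl by (simp add: \<nu>)
  qed
  moreover have "X o\<^sub>L Y = 0"
    if "X \<in> measure_support \<nu>" "Y \<in> measure_support \<nu>" "X \<noteq> Y" for X Y
    using measure_support_orthogonal[of w P X Y] w wl R(3) that unfolding \<nu> by blast
  moreover have "\<nu> \<in> prob_Pc" using \<mu> by (simp add: D1_perp_def D1_def)
  ultimately show "\<exists>w P. orth_rep w P \<and> \<nu> = dirac_sum w P"
    using ex_orth_rep[OF sep] by metis
next
  assume "\<exists>w P. orth_rep w P \<and> \<nu> = dirac_sum w P"
  then obtain w P where w: "orth_rep w P" "\<nu> = dirac_sum w P" by blast
  show "\<nu> \<in> tr_measure ` D1_perp"
    unfolding w(2) tr_measure_of_orth_rep(4)[OF sep w(1), symmetric]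
    by (rule imageI) (rule tr_measure_of_orth_rep(3)[OF sep w(1)])
qed

text \<open>A probability measure outside the set either has 0 in its support, and then charges the unit ball
  around 0, or has two distinct points with nonzero product in its support, and then charges small
  balls around both. Charging finitely many balls is a weakly open condition, and no member of the
  set charges these.\<close>

lemma closedin_tr_D1_perp:
  assumes sep: "separable_space (euclidean :: 'h::complex_hilbert_space topology)"
  shows "closedin weak_topology (tr_measure ` (D1_perp :: ('h \<Rightarrow>\<^sub>L 'h) measure set))"
    (is "closedin _ ?D")
proof -
  have sub: "?D \<subseteq> prob_Pc" by (auto simp: D1_perp_def D1_def)
  have D: "?D = {\<nu>. \<exists>w P. orth_rep w P \<and> \<nu> = dirac_sum w P}"
    using tr_D1_perp_iff[OF sep] by blast
  have "openin weak_topology (prob_Pc - ?D)"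
  proof (subst openin_subopen, rule ballI)
    fix \<nu> assume \<nu>: "\<nu> \<in> prob_Pc - ?D"
    define W where "W P e = {\<nu>\<in>prob_Pc. 0 < emeasure \<nu> (ball P e \<inter> Pc)}"
      for P :: "'h \<Rightarrow>\<^sub>L 'h" and e
    have W: "openin weak_topology (W P e)" if "0 < e" for P e
      unfolding W_def by (rule openin_weak_topology_ball[OF that])
    have W_prob: "W P e \<subseteq> prob_Pc" for P e by (auto simp: W_def)
    have W_supp: "\<nu> \<in> W P e" if "P \<in> measure_support \<nu>" "0 < e" for P e
      using that \<nu> unfolding W_def measure_support_def by (auto simp: prob_PcD)
    have atom: "\<exists>i. 0 < w i \<and> Q i \<in> ball P e" if "dirac_sum w Q \<in> W P e" "orth_rep w Q" for P e w Q
    proof -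
      have pos: "0 < emeasure (dirac_sum w Q) (ball P e \<inter> Pc)" "\<And>i. 0 \<le> w i"
        using that by (auto simp: W_def orth_rep_def)
      obtain i where "0 < w i" "Q i \<in> ball P e"
        by (rule atom_in_of_emeasure_pos[OF open_ball pos])
      then show ?thesis by blast
    qed
    have "0 \<in> measure_support \<nu> \<or> (\<exists>P Q. P \<in> measure_support \<nu> \<and> Q \<in> measure_support \<nu> \<and>
        P \<noteq> Q \<and> P o\<^sub>L Q \<noteq> 0)"
    proof (rule ccontr)
      assume neg: "\<not> ?thesis"
      have "\<nu> \<in> prob_Pc" using \<nu> by blast
      then obtain w P where "orth_rep w P" "\<nu> = dirac_sum w P"
        by (rule ex_orth_rep[OF sep]) (use neg in blast)+
      then have "\<nu> \<in> ?D" unfolding D by blast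
      then show False using \<nu> by blast
    qed
    then show "\<exists>T. openin weak_topology T \<and> \<nu> \<in> T \<and> T \<subseteq> prob_Pc - ?D"
    proof
      assume "0 \<in> measure_support \<nu>"
      moreover have "dirac_sum w P \<notin> W 0 1" if "orth_rep w P" for w P
        using dirac_sum_unit_ball_null[of w P] that by (auto simp: W_def orth_rep_def)
      then have "W 0 1 \<subseteq> prob_Pc - ?D"
        using W_prob unfolding D by blast
      ultimately show ?thesis using W[of 1 0] W_supp[of 0 1] by auto
    next
      assume "\<exists>P Q. P \<in> measure_support \<nu> \<and> Q \<in> measure_support \<nu> \<and> P \<noteq> Q \<and> P o\<^sub>L Q \<noteq> 0"
      then obtain P Q where PQ: "P \<in> measure_support \<nu>" "Q \<in> measure_support \<nu>"
        "P \<noteq> Q" "P o\<^sub>L Q \<noteq> 0" by blast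
      obtain e where e: "0 < e"
        "\<And>P' Q'. P' \<in> ball P e \<Longrightarrow> Q' \<in> ball Q e \<Longrightarrow> P' \<noteq> Q' \<and> P' o\<^sub>L Q' \<noteq> 0"
        by (rule nonorthogonal_pairs_open[OF PQ(3,4)]) blast
      have "dirac_sum w R \<notin> W P e \<inter> W Q e" if wR: "orth_rep w R" for w R
      proof
        assume "dirac_sum w R \<in> W P e \<inter> W Q e"
        then obtain i j where ij: "0 < w i" "R i \<in> ball P e" "0 < w j" "R j \<in> ball Q e"
          using atom[OF _ wR, of P e] atom[OF _ wR, of Q e] by auto
        then have "R i \<noteq> R j \<and> R i o\<^sub>L R j \<noteq> 0" by (intro e(2))
        moreover from this have "i \<noteq> j" by blast
        ultimately show False using ij(1,3) wR by (simp add: orth_rep_def)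
      qed
      then have "W P e \<inter> W Q e \<subseteq> prob_Pc - ?D"
        using W_prob unfolding D by blast
      moreover have "\<nu> \<in> W P e \<inter> W Q e" using W_supp PQ e(1) by blast
      moreover have "openin weak_topology (W P e \<inter> W Q e)" by (intro openin_Int W e(1))
      ultimately show ?thesis by (intro exI[of _ "W P e \<inter> W Q e"]) simp
    qed
  qed
  then show ?thesis
    using sub by (simp add: closedin_def topspace_weak_topology)
qed


section \<open>Decompositions of a given operator\<close>

text \<open>The matrix coefficient divided by the trace. The maximum with 1 only changes the denominator at
  the zero projection, where the numerator vanishes, and keeps it continuous and bounded below.\<close>

definition moment :: "'h \<Rightarrow> 'h \<Rightarrow> ('h::complex_hilbert_space \<Rightarrow>\<^sub>L 'h) \<Rightarrow> real" where
  "moment x y Q = Re (cinner x (Q y)) / max 1 (real (rk Q))"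

lemma bounded_linear_Re_cinner_blinfun:
  "bounded_linear (\<lambda>Q :: 'h::complex_hilbert_space \<Rightarrow>\<^sub>L 'h. Re (cinner x (Q y)))"
  by (rule bounded_linear_compose[OF bounded_linear_Re
        bounded_linear_compose[OF cinner.bounded_linear_right blinfun.bounded_linear_left]])

lemma continuous_on_moment: "continuous_on Pc (moment x y)"
proof -
  have "continuous_on Pc (\<lambda>Q. Re (cinner x (blinfun_apply Q y)) / max 1 (real (rk Q)))"
    by (intro continuous_on_divide continuous_on_max continuous_on_rk continuous_on_const
        linear_continuous_on bounded_linear_Re_cinner_blinfun) auto
  then show ?thesis by (simp add: moment_def[abs_def])
qed

lemma abs_moment_le:
  assumes "Q \<in> Pc"
  shows "\<bar>moment x y Q\<bar> \<le> norm x * norm y"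
proof -
  have "\<bar>moment x y Q\<bar> \<le> \<bar>Re (cinner x (Q y))\<bar> / 1"
    unfolding moment_def abs_divide by (intro divide_left_mono) auto
  also have "\<dots> \<le> cmod (cinner x (Q y))" by (simp add: abs_Re_le_cmod)
  also have "\<dots> \<le> norm x * norm (Q y)" by (rule Cauchy_Schwarz_cinner)
  also have "\<dots> \<le> norm x * norm y"
    by (intro mult_left_mono is_proj_norm_le PcD assms) auto
  finally show ?thesis .
qed

text \<open>Integrating the normalised matrix coefficients against \<open>tr(\<cdot>)\<mu>\<close> gives the matrix coefficients
  of \<open>\<Sum>\<^sub>i l\<^sub>i P\<^sub>i\<close>, and an operator is determined by those. The series converges absolutely
  because \<open>norm P\<^sub>i \<le> 1 \<le> tr(P\<^sub>i)\<close> whenever \<open>P\<^sub>i \<noteq> 0\<close>.\<close>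

lemma moments_eq_iff_sums:
  fixes \<rho> :: "'h::complex_hilbert_space \<Rightarrow>\<^sub>L 'h"
  assumes rep: "is_dirac_rep l P" and w1: "(\<lambda>i. l i * rk (P i)) sums 1"
  shows "(\<forall>x y. (\<integral>Q. moment x y Q \<partial>dirac_sum (\<lambda>i. l i * rk (P i)) P) = Re (cinner x (\<rho> y)))
    \<longleftrightarrow> (\<lambda>i. l i *\<^sub>R P i) sums \<rho>"
proof -
  have P: "\<And>i. P i \<in> Pc" and l: "\<And>i. 0 \<le> l i"
    using rep by (auto simp: is_dirac_rep_def)
  have eq: "l i * rk (P i) * moment x y (P i) = l i * Re (cinner x (P i y))" for x y i
    using rk_ge_1[OF P, of i]
    by (cases "P i = 0") (auto simp: moment_def max_def cinner.zero_right)
  have s: "(\<lambda>i. l i * Re (cinner x (P i y)))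
      sums (\<integral>Q. moment x y Q \<partial>dirac_sum (\<lambda>i. l i * rk (P i)) P)" for x y
    using integral_dirac_sum[OF _ w1, of P "moment x y" "norm x * norm y"] P l
    by (simp add: eq continuous_on_moment abs_moment_le)
  have "summable (\<lambda>i. l i *\<^sub>R P i)"
  proof (rule summable_comparison_test')
    show "summable (\<lambda>i. l i * rk (P i))" using w1 by (rule sums_summable)
    show "norm (l i *\<^sub>R P i) \<le> l i * rk (P i)" for i
      using rk_ge_1[OF P, of i] is_proj_norm_le_1[OF PcD[OF P[of i]]] l[of i]
      by (cases "P i = 0") (auto intro!: mult_left_mono)
  qed
  then obtain T where T: "(\<lambda>i. l i *\<^sub>R P i) sums T" by (auto simp: summable_def)
  have "(\<integral>Q. moment x y Q \<partial>dirac_sum (\<lambda>i. l i * rk (P i)) P) = Re (cinner x (T y))" for x y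
  proof -
    have "(\<lambda>i. Re (cinner x ((l i *\<^sub>R P i) y))) sums Re (cinner x (T y))"
      by (rule bounded_linear.sums[OF bounded_linear_Re_cinner_blinfun T])
    then have "(\<lambda>i. l i * Re (cinner x (P i y))) sums Re (cinner x (T y))"
      by (simp add: blinfun.scaleR_left cinner.scaleR_right)
    then show ?thesis using s[of x y] sums_unique2 by blast
  qed
  then have "(\<forall>x y. (\<integral>Q. moment x y Q \<partial>dirac_sum (\<lambda>i. l i * rk (P i)) P) = Re (cinner x (\<rho> y)))
      \<longleftrightarrow> T = \<rho>"
    using Re_cinner_eqI[of T \<rho>] by auto
  also have "\<dots> \<longleftrightarrow> (\<lambda>i. l i *\<^sub>R P i) sums \<rho>" using T sums_unique2 by blast
  finally show ?thesis .
qed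

text \<open>Prescribing \<open>\<Sum>\<^sub>i l\<^sub>i P\<^sub>i\<close> amounts to prescribing the integrals of bounded continuous functions
  against \<open>tr(\<cdot>)\<mu>\<close>, which is a closed condition.\<close>

lemma tr_Lambda_perp_iff:
  fixes \<nu> :: "('h::complex_hilbert_space \<Rightarrow>\<^sub>L 'h) measure"
  assumes sep: "separable_space (euclidean :: 'h topology)"
  shows "\<nu> \<in> tr_measure ` Lambda_perp \<phi> \<longleftrightarrow> \<nu> \<in> tr_measure ` D1_perp \<and>
    (\<forall>x y. (\<integral>Q. moment x y Q \<partial>\<nu>) = Re (cinner x (density_matrix \<phi> y)))"
proof
  assume "\<nu> \<in> tr_measure ` Lambda_perp \<phi>"
  then obtain \<mu> l P where \<mu>: "\<mu> \<in> D1_perp" "\<nu> = tr_measure \<mu>" "is_dirac_rep l P"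
      "\<mu> = dirac_sum l P" "(\<lambda>i. l i *\<^sub>R P i) sums density_matrix \<phi>"
    by (auto simp: Lambda_perp_def)
  have \<nu>: "\<nu> = dirac_sum (\<lambda>i. l i * rk (P i)) P"
    using \<mu> tr_measure_dirac_sum[OF sep] by simp
  moreover have "\<nu> \<in> prob_Pc" using \<mu>(1,2) by (simp add: D1_perp_def D1_def)
  ultimately have "(\<lambda>i. l i * rk (P i)) sums 1"
    using dirac_sum_in_prob_Pc_iff[of "\<lambda>i. l i * rk (P i)" P] \<mu>(3)
    by (simp add: is_dirac_rep_def)
  then have "\<forall>x y. (\<integral>Q. moment x y Q \<partial>\<nu>) = Re (cinner x (density_matrix \<phi> y))"
    using moments_eq_iff_sums[OF \<mu>(3), of "density_matrix \<phi>"] \<mu>(5) unfolding \<nu> by blast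
  then show "\<nu> \<in> tr_measure ` D1_perp \<and>
    (\<forall>x y. (\<integral>Q. moment x y Q \<partial>\<nu>) = Re (cinner x (density_matrix \<phi> y)))"
    using \<mu>(1,2) by blast
next
  assume A: "\<nu> \<in> tr_measure ` D1_perp \<and>
    (\<forall>x y. (\<integral>Q. moment x y Q \<partial>\<nu>) = Re (cinner x (density_matrix \<phi> y)))"
  then obtain \<mu> where \<mu>: "\<mu> \<in> D1_perp" "\<nu> = tr_measure \<mu>" by blast
  then obtain l P where R: "is_dirac_rep l P" "\<mu> = dirac_sum l P" "(\<lambda>i. l i * rk (P i)) sums 1"
    unfolding D1_perp_iff[OF sep] by blast
  have "\<nu> = dirac_sum (\<lambda>i. l i * rk (P i)) P"
    using \<mu> R tr_measure_dirac_sum[OF sep] by simp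
  then have "(\<lambda>i. l i *\<^sub>R P i) sums density_matrix \<phi>"
    using moments_eq_iff_sums[OF R(1,3), of "density_matrix \<phi>"] A by simp
  then have "\<mu> \<in> Lambda_perp \<phi>" using \<mu>(1) R by (auto simp: Lambda_perp_def)
  then show "\<nu> \<in> tr_measure ` Lambda_perp \<phi>" using \<mu>(2) by blast
qed

lemma closedin_tr_Lambda_perp:
  fixes \<phi> :: "('h::complex_hilbert_space \<Rightarrow>\<^sub>L 'h) \<Rightarrow> complex"
  assumes sep: "separable_space (euclidean :: 'h topology)"
  shows "closedin weak_topology (tr_measure ` Lambda_perp \<phi>)"
proof -
  define E where "E x y = {\<nu>\<in>prob_Pc. (\<integral>Q. moment x y Q \<partial>\<nu>) = Re (cinner x (density_matrix \<phi> y))}"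
    for x y
  have "closedin weak_topology (E x y)" for x y
  proof -
    have "openin weak_topology
        {\<nu>\<in>prob_Pc. (\<integral>Q. moment x y Q \<partial>\<nu>) \<in> - {Re (cinner x (density_matrix \<phi> y))}}"
      using abs_moment_le[of _ x y]
      by (intro openin_weak_topology_integral continuous_on_moment
          boundedI[where B = "norm x * norm y"]) auto
    moreover have "prob_Pc - E x y =
        {\<nu>\<in>prob_Pc. (\<integral>Q. moment x y Q \<partial>\<nu>) \<in> - {Re (cinner x (density_matrix \<phi> y))}}"
      by (auto simp: E_def)
    ultimately show ?thesis
      by (simp add: closedin_def topspace_weak_topology E_def)
  qed
  then have "closedin weak_topology (\<Inter>x. \<Inter>y. E x y)"
    by (intro closedin_INT) auto
  moreover have "tr_measure ` Lambda_perp \<phi> = tr_measure ` D1_perp \<inter> (\<Inter>x. \<Inter>y. E x y)"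
    using tr_Lambda_perp_iff[OF sep, of _ \<phi>]
    by (auto simp: E_def D1_perp_def D1_def set_eq_iff)
  ultimately show ?thesis
    using closedin_tr_D1_perp[OF sep] by (simp add: closedin_Int)
qed

lemma tr_Lambda_perp_orth_rep:
  fixes \<nu> :: "('h::complex_hilbert_space \<Rightarrow>\<^sub>L 'h) measure"
  assumes sep: "separable_space (euclidean :: 'h topology)"
    and \<nu>: "\<nu> \<in> tr_measure ` Lambda_perp \<phi>"
  obtains w P where "orth_rep w P" "\<nu> = dirac_sum w P"
    "(\<lambda>i. (w i / rk (P i)) *\<^sub>R P i) sums density_matrix \<phi>"
proof -
  obtain w P where w: "orth_rep w P" "\<nu> = dirac_sum w P"
    using \<nu> tr_Lambda_perp_iff[OF sep] tr_D1_perp_iff[OF sep] by blast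
  note t = tr_measure_of_orth_rep[OF sep w(1)]
  have "(\<lambda>i. w i / rk (P i) * rk (P i)) sums 1"
    unfolding t(2) using w(1) by (simp add: orth_rep_def)
  then have "(\<lambda>i. (w i / rk (P i)) *\<^sub>R P i) sums density_matrix \<phi>"
    using moments_eq_iff_sums[OF t(1), of "density_matrix \<phi>"] \<nu>
      tr_Lambda_perp_iff[OF sep, of \<nu> \<phi>] w(2)
    unfolding t(2) by simp
  then show ?thesis using that w by blast
qed


section \<open>Spectral projections\<close>

text \<open>The weight \<open>w i\<close> of the atom \<open>P i\<close> is split into \<open>rk (P i)\<close> equal parts, with \<open>n\<close> encoding the
  pair of \<open>i\<close> and the number of the part. If the atoms decompose \<open>\<rho>\<close>, the positive values are the
  positive eigenvalues of \<open>\<rho>\<close>, listed with multiplicity.\<close>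

definition unrolled :: "(nat \<Rightarrow> real) \<Rightarrow> (nat \<Rightarrow> 'h::complex_hilbert_space \<Rightarrow>\<^sub>L 'h) \<Rightarrow> nat \<Rightarrow> real" where
  "unrolled w P n = (case prod_decode n of (i, s) \<Rightarrow> if s < rk (P i) then w i / rk (P i) else 0)"

lemma unrolled_nonneg: "orth_rep w P \<Longrightarrow> 0 \<le> unrolled w P n"
  by (auto simp: unrolled_def orth_rep_def split: prod.split)

lemma dirac_sum_unrolled:
  assumes "orth_rep w P"
  shows "dirac_sum (unrolled w P) (\<lambda>n. P (fst (prod_decode n))) = dirac_sum w P"
proof (rule measure_eqI)
  let ?T = "\<lambda>n. P (fst (prod_decode n))"
  have w: "0 \<le> w i" and rk: "1 \<le> real (rk (P i))" for i
    using assms rk_ge_1[of "P i"] by (auto simp: orth_rep_def)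
  fix A assume "A \<in> sets (dirac_sum (unrolled w P) ?T)"
  then have A: "A \<in> sets borel_Pc" by simp
  define F where "F = (\<lambda>(i, s). ennreal (if s < rk (P i) then w i / rk (P i) else 0) * indicator A (P i))"
  have inner: "(\<Sum>s. F (i, s)) = ennreal (w i) * indicator A (P i)" for i
  proof -
    have "(\<Sum>s. F (i, s)) = (\<Sum>s<rk (P i). F (i, s))"
      by (rule suminf_finite) (auto simp: F_def)
    also have "\<dots> = (\<Sum>s<rk (P i). ennreal (w i / rk (P i)) * indicator A (P i))"
      by (rule sum.cong) (auto simp: F_def)
    also have "\<dots> = ennreal (rk (P i) * (w i / rk (P i))) * indicator A (P i)"
    proof -
      have "of_nat (rk (P i)) * ennreal (w i / rk (P i)) = ennreal (rk (P i) * (w i / rk (P i)))"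
        using w[of i] by (subst ennreal_mult) (auto simp: ennreal_of_nat_eq_real_of_nat)
      then show ?thesis by (simp flip: mult.assoc)
    qed
    also have "rk (P i) * (w i / rk (P i)) = w i" using rk[of i] by simp
    finally show ?thesis .
  qed
  have "emeasure (dirac_sum (unrolled w P) ?T) A = (\<integral>\<^sup>+n. F (prod_decode n) \<partial>count_space UNIV)"
    using emeasure_dirac_sum[OF A]
    by (simp add: nn_integral_count_space_nat F_def unrolled_def case_prod_beta)
  also have "\<dots> = (\<integral>\<^sup>+z. F z \<partial>count_space UNIV)"
    by (rule nn_integral_bij_count_space[OF bij_prod_decode])
  also have "\<dots> = (\<integral>\<^sup>+i. \<integral>\<^sup>+s. F (i, s) \<partial>count_space UNIV \<partial>count_space UNIV)"
    by (rule nn_integral_fst_count_space[symmetric])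
  also have "\<dots> = emeasure (dirac_sum w P) A"
    using emeasure_dirac_sum[OF A] by (simp add: nn_integral_count_space_nat inner)
  finally show "emeasure (dirac_sum (unrolled w P) ?T) A = emeasure (dirac_sum w P) A" .
qed simp

text \<open>By orthogonality only the \<open>j\<close>-th term of the series survives multiplication by \<open>P j\<close>.\<close>

lemma orth_rep_operator_atom:
  assumes "orth_rep w P" and \<rho>: "(\<lambda>i. (w i / rk (P i)) *\<^sub>R P i) sums \<rho>" and j: "0 < w j"
  shows "\<rho> (P j x) = (w j / rk (P j)) *\<^sub>R P j x" "P j (\<rho> x) = (w j / rk (P j)) *\<^sub>R P j x"
proof -
  have pr: "is_proj (P i)" for i using assms(1) by (auto simp: orth_rep_def intro: PcD)
  have orth: "P i o\<^sub>L P j = 0" "P j o\<^sub>L P i = 0" if "i \<noteq> j" "w i \<noteq> 0" for i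
    using assms(1) that j unfolding orth_rep_def by (metis less_le)+
  have 1: "((w i / rk (P i)) *\<^sub>R P i) (P j x) = (if i = j then (w j / rk (P j)) *\<^sub>R P j x else 0)"
    and 2: "P j (((w i / rk (P i)) *\<^sub>R P i) x) = (if i = j then (w j / rk (P j)) *\<^sub>R P j x else 0)" for i
    using arg_cong[OF orth(1), of i "\<lambda>T. T x"] arg_cong[OF orth(2), of i "\<lambda>T. T x"]
    by (auto simp: blinfun.scaleR_left blinfun.scaleR_right is_proj_idem[OF pr])
  have "(\<lambda>i. ((w i / rk (P i)) *\<^sub>R P i) (P j x)) sums \<rho> (P j x)"
    by (rule bounded_linear.sums[OF blinfun.bounded_linear_left \<rho>])
  then show "\<rho> (P j x) = (w j / rk (P j)) *\<^sub>R P j x"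
    unfolding 1 using sums_single[of j "\<lambda>_. (w j / rk (P j)) *\<^sub>R P j x"] sums_unique2 by blast
  have "(\<lambda>i. P j (((w i / rk (P i)) *\<^sub>R P i) x)) sums P j (\<rho> x)"
    by (rule bounded_linear.sums[OF bounded_linear_compose[OF blinfun.bounded_linear_right
            blinfun.bounded_linear_left] \<rho>])
  then show "P j (\<rho> x) = (w j / rk (P j)) *\<^sub>R P j x"
    unfolding 2 using sums_single[of j "\<lambda>_. (w j / rk (P j)) *\<^sub>R P j x"] sums_unique2 by blast
qed

text \<open>The projection \<open>E\<close> is the sum of the atoms \<open>P i\<close> with \<open>w i / rk (P i) = a\<close>. There are finitely
  many, since each has mass at least \<open>a\<close>, and the number of parts that they are split into is the
  sum of their ranks. The eigenspace, and with it \<open>E\<close>, depends only on \<open>\<rho>\<close>: this is how two different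
  decompositions of the same operator are compared.\<close>

lemma spectral_projection:
  assumes rep: "orth_rep w P" and \<rho>: "(\<lambda>i. (w i / rk (P i)) *\<^sub>R P i) sums \<rho>" and a: "0 < a"
  obtains E where "E \<in> Pc" "\<And>x. \<rho> x = a *\<^sub>R x \<longleftrightarrow> E x = x"
    "finite {n. unrolled w P n = a}" "card {n. unrolled w P n = a} = rk E"
proof -
  have w0: "0 \<le> w i" and w1: "w sums 1" and P: "P i \<in> Pc" "1 \<le> real (rk (P i))" for i
    using rep rk_ge_1[of "P i"] by (auto simp: orth_rep_def)
  have pr: "is_proj (P i)" for i by (rule PcD[OF P(1)])
  define J where "J = {i. w i / rk (P i) = a}"
  have wJ: "0 < w i" if "i \<in> J" for i
    using that a w0[of i] by (cases "w i = 0") (auto simp: J_def less_le)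
  have "finite J"
  proof -
    have "w \<longlonglongrightarrow> 0" using w1 by (intro summable_LIMSEQ_zero) (rule sums_summable)
    then have "\<forall>\<^sub>F i in sequentially. w i < a" using a by (rule order_tendstoD)
    then obtain N where N: "\<And>i. N \<le> i \<Longrightarrow> w i < a" by (auto simp: eventually_sequentially)
    have "i < N" if "i \<in> J" for i
    proof -
      have "a \<le> w i"
        using that P(2)[of i] a mult_left_mono[of 1 "real (rk (P i))" a]
        by (simp add: J_def field_simps)
      then show ?thesis using N[of i] by (meson leD leI)
    qed
    then show ?thesis by (meson bounded_nat_set_is_finite)
  qed
  define E where "E = (\<Sum>i\<in>J. P i)"
  have E: "E \<in> Pc" "rk E = (\<Sum>i\<in>J. rk (P i))"
    using Pc_sum_orthogonal[OF \<open>finite J\<close>, of P] P(1) rep wJ unfolding E_def orth_rep_def by auto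
  have "\<rho> x = a *\<^sub>R x \<longleftrightarrow> E x = x" for x
  proof
    assume x: "\<rho> x = a *\<^sub>R x"
    have "(w i / rk (P i)) *\<^sub>R P i x = 0" if "i \<notin> J" for i
    proof (cases "w i = 0")
      case False
      then have "P i (\<rho> x) = (w i / rk (P i)) *\<^sub>R P i x"
        using orth_rep_operator_atom(2)[OF rep \<rho>] w0[of i] by simp
      then have "(w i / rk (P i)) *\<^sub>R P i x = a *\<^sub>R P i x"
        unfolding x blinfun.scaleR_right by (rule sym)
      moreover have "w i / rk (P i) \<noteq> a" using that by (simp add: J_def)
      ultimately show ?thesis by (metis scaleR_cancel_right scaleR_zero_right)
    qed simp
    then have "(\<lambda>i. (w i / rk (P i)) *\<^sub>R P i x) sums (\<Sum>i\<in>J. (w i / rk (P i)) *\<^sub>R P i x)"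
      by (intro sums_finite \<open>finite J\<close>)
    moreover have "(\<lambda>i. (w i / rk (P i)) *\<^sub>R P i x) sums \<rho> x"
      using bounded_linear.sums[OF blinfun.bounded_linear_left \<rho>, of x]
      by (simp add: blinfun.scaleR_left)
    ultimately have "\<rho> x = (\<Sum>i\<in>J. (w i / rk (P i)) *\<^sub>R P i x)" by (rule sums_unique2[rotated])
    also have "\<dots> = a *\<^sub>R E x"
      by (auto simp: E_def blinfun.sum_left scaleR_sum_right J_def intro: sum.cong)
    finally show "E x = x" using x a by simp
  next
    assume x: "E x = x"
    have "\<rho> x = (\<Sum>i\<in>J. \<rho> (P i x))"
      by (subst x[symmetric]) (simp add: E_def blinfun.sum_left blinfun.sum_right)
    also have "\<dots> = (\<Sum>i\<in>J. a *\<^sub>R P i x)"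
      by (intro sum.cong refl) (simp add: orth_rep_operator_atom(1)[OF rep \<rho> wJ], simp add: J_def)
    also have "\<dots> = a *\<^sub>R E x"
      by (simp add: E_def blinfun.sum_left scaleR_sum_right)
    finally show "\<rho> x = a *\<^sub>R x" using x by simp
  qed
  moreover have "{n. unrolled w P n = a} = prod_encode ` (SIGMA i:J. {..<rk (P i)})"
  proof (intro set_eqI iffI)
    fix n assume n: "n \<in> {n. unrolled w P n = a}"
    obtain i s where dec: "prod_decode n = (i, s)" by (cases "prod_decode n")
    then have "n = prod_encode (i, s)" by (metis prod_decode_inverse)
    then show "n \<in> prod_encode ` (SIGMA i:J. {..<rk (P i)})"
      using n a dec by (auto simp: unrolled_def J_def split: if_splits)
  qed (auto simp: unrolled_def J_def)
  moreover have "card (prod_encode ` (SIGMA i:J. {..<rk (P i)})) = rk E"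
    using \<open>finite J\<close> E(2) by (simp add: card_image inj_prod_encode)
  ultimately show ?thesis
    using that[OF E(1)] \<open>finite J\<close> by simp
qed

lemma Pc_eq_of_fixed_points:
  assumes "E \<in> Pc" "E' \<in> Pc" "\<And>x. E x = x \<longleftrightarrow> E' x = x"
  shows "E = E'"
proof -
  note pr = PcD[OF assms(1)] PcD[OF assms(2)]
  have 1: "E o\<^sub>L E' = E'" "E' o\<^sub>L E = E"
    using assms(3) is_proj_idem[OF pr(1)] is_proj_idem[OF pr(2)]
    by (auto intro!: blinfun_eqI)
  then show ?thesis using is_proj_absorb[OF pr 1(1)] by simp
qed

text \<open>Choose a bijection between the level sets for each positive value and glue.\<close>

lemma ex_bij_levels:
  fixes f g :: "nat \<Rightarrow> real"
  assumes "\<And>a. 0 < a \<Longrightarrow> finite {n. f n = a} \<and> finite {n. g n = a} \<and> card {n. f n = a} = card {n. g n = a}"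
  obtains h where "bij_betw h {n. 0 < f n} {n. 0 < g n}" "\<And>n. 0 < f n \<Longrightarrow> g (h n) = f n"
proof -
  have "\<forall>a. \<exists>H. 0 < a \<longrightarrow> bij_betw H {n. f n = a} {n. g n = a}"
    using assms finite_same_card_bij by blast
  then obtain H where H: "\<And>a. 0 < a \<Longrightarrow> bij_betw (H a) {n. f n = a} {n. g n = a}" by metis
  define h where "h n = H (f n) n" for n
  have gh: "g (h n) = f n" if "0 < f n" for n
    using bij_betwE[OF H[OF that]] by (auto simp: h_def)
  have "bij_betw h {n. 0 < f n} {n. 0 < g n}"
    unfolding bij_betw_def
  proof (intro conjI set_eqI iffI inj_onI)
    fix m n assume mn: "m \<in> {n. 0 < f n}" "n \<in> {n. 0 < f n}" "h m = h n"
    then have eq: "f m = f n" using gh by (metis mem_Collect_eq)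
    then have "H (f n) m = H (f n) n" using mn(3) by (simp add: h_def)
    then show "m = n" using H[of "f n"] mn eq by (auto simp: bij_betw_def inj_on_def)
  next
    fix y assume "y \<in> {n. 0 < g n}"
    then obtain x where "f x = g y" "H (g y) x = y"
      using H[of "g y"] by (auto simp: bij_betw_def image_iff set_eq_iff) metis
    then show "y \<in> h ` {n. 0 < f n}"
      using \<open>y \<in> {n. 0 < g n}\<close> by (intro image_eqI[of _ _ x]) (auto simp: h_def)
  qed (use gh in auto)
  then show ?thesis using that gh by blast
qed

lemma dirac_sum_reindex:
  fixes T :: "nat \<Rightarrow> 'h::complex_hilbert_space \<Rightarrow>\<^sub>L 'h"
  assumes f: "\<And>n. 0 \<le> f n" and g: "\<And>n. 0 \<le> g n"
    and h: "bij_betw h {n. 0 < f n} {n. 0 < g n}" "\<And>n. 0 < f n \<Longrightarrow> g (h n) = f n"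
  shows "dirac_sum g T = dirac_sum f (\<lambda>n. T (h n))"
proof (rule measure_eqI)
  fix A assume "A \<in> sets (dirac_sum g T)"
  then have A: "A \<in> sets borel_Pc" by simp
  have pos: "(\<Sum>n. ennreal (f n) * indicator A (T n))
      = (\<integral>\<^sup>+n. ennreal (f n) * indicator A (T n) \<partial>count_space {n. 0 < f n})"
    if "\<And>n. 0 \<le> f n" for f :: "nat \<Rightarrow> real" and T :: "nat \<Rightarrow> 'h \<Rightarrow>\<^sub>L 'h"
    unfolding nn_integral_count_space_nat[symmetric]
    by (rule nn_integral_count_space_eq) (use that in \<open>auto simp: less_le\<close>)
  have "emeasure (dirac_sum g T) A
      = (\<integral>\<^sup>+n. ennreal (g (h n)) * indicator A (T (h n)) \<partial>count_space {n. 0 < f n})"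
    using emeasure_dirac_sum[OF A] pos[OF g]
      nn_integral_bij_count_space[OF h(1), of "\<lambda>n. ennreal (g n) * indicator A (T n)"] by simp
  also have "\<dots> = (\<integral>\<^sup>+n. ennreal (f n) * indicator A (T (h n)) \<partial>count_space {n. 0 < f n})"
    by (rule nn_integral_cong) (simp add: h(2))
  also have "\<dots> = emeasure (dirac_sum f (\<lambda>n. T (h n))) A"
    using emeasure_dirac_sum[OF A] pos[OF f, where T = "\<lambda>n. T (h n)"] by simp
  finally show "emeasure (dirac_sum g T) A = emeasure (dirac_sum f (\<lambda>n. T (h n))) A" .
qed simp


section \<open>Compactness of the set of decompositions\<close>

lemma compact_Pi_UNIV:
  fixes S :: "'i \<Rightarrow> 'a::topological_space set"
  assumes "\<And>i. compact (S i)"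
  shows "compact {T. \<forall>i. T i \<in> S i}"
proof -
  have "compactin (product_topology (\<lambda>i. euclidean) UNIV) (PiE UNIV S)"
    using assms by (simp add: compactin_PiE)
  moreover have "PiE UNIV S = {T. \<forall>i. T i \<in> S i}" by (auto simp: PiE_def Pi_def extensional_def)
  ultimately show ?thesis by (simp add: euclidean_product_topology)
qed

text \<open>A projection below \<open>E\<close> is determined by its matrix with respect to an orthonormal basis of the
  range of \<open>E\<close>, and the entries of that matrix are bounded. So the set is a closed subset of a
  continuous image of a product of discs.\<close>

lemma compact_subprojections:
  fixes E :: "'h::complex_hilbert_space \<Rightarrow>\<^sub>L 'h"
  assumes "E \<in> Pc"
  shows "compact {Q \<in> Pc. E o\<^sub>L Q = Q}"
proof -
  obtain G where G: "finite G" "orthonormal G" "E = proj_onto G"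
    using Pc_proj_onto[OF assms] by blast
  define \<Phi> where "\<Phi> c = (\<Sum>(g, h)\<in>G \<times> G. rank_one (c (g, h) *\<^sub>C g) h)" for c :: "'h \<times> 'h \<Rightarrow> complex"
  define K where "K = {c :: 'h \<times> 'h \<Rightarrow> complex. \<forall>z. c z \<in> cball 0 (norm (fst z) * norm (snd z))}"
  have "compact K" unfolding K_def by (intro compact_Pi_UNIV compact_cball)
  moreover have "continuous_on UNIV \<Phi>"
    unfolding \<Phi>_def case_prod_beta
    by (intro continuous_on_sum rank_one.continuous_on scaleC.continuous_on
        continuous_on_product_coordinates continuous_on_const)
  ultimately have "compact (\<Phi> ` K)"
    by (intro compact_continuous_image) (auto intro: continuous_on_subset)
  moreover have "closed {Q :: 'h \<Rightarrow>\<^sub>L 'h. is_proj Q \<and> E o\<^sub>L Q = Q}"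
    unfolding is_proj_def selfadjoint_op_def BH_def mem_Collect_eq
    by (intro closed_Collect_conj closed_Collect_all closed_Collect_eq continuous_on_id
        bounded_bilinear.continuous_on[OF bounded_bilinear_blinfun_compose] continuous_on_const
        cinner.continuous_on scaleC.continuous_on blinfun.continuous_on)
  moreover have "{Q \<in> Pc. E o\<^sub>L Q = Q} = \<Phi> ` K \<inter> {Q. is_proj Q \<and> E o\<^sub>L Q = Q}"
  proof (intro set_eqI iffI)
    fix Q assume "Q \<in> {Q \<in> Pc. E o\<^sub>L Q = Q}"
    then have Q: "is_proj Q" "E o\<^sub>L Q = Q" by (auto intro: PcD)
    then have QE: "Q o\<^sub>L E = Q" using is_proj_absorb[OF PcD[OF assms]] by blast
    define c where "c z = cinner (fst z) (Q (snd z))" for z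
    have "c \<in> K"
    proof -
      have "cmod (cinner g (Q h)) \<le> norm g * norm h" for g h
        using Cauchy_Schwarz_cinner[of g "Q h"] is_proj_norm_le[OF Q(1), of h]
          mult_left_mono[of "norm (Q h)" "norm h" "norm g"] by simp
      then show ?thesis by (simp add: K_def c_def)
    qed
    moreover have "Q = \<Phi> c"
    proof (rule blinfun_eqI)
      fix x
      have "Q x = E (Q (E x))"
        using Q(2) QE by (metis blinfun_apply_blinfun_compose)
      also have "\<dots> = (\<Sum>g\<in>G. \<Sum>h\<in>G. (cinner h x * cinner g (Q h)) *\<^sub>C g)"
        unfolding G(3) proj_onto_apply blinfun.sum_right is_proj_scaleC[OF Q(1)]
          cinner.sum_right cinner_scaleC_right scaleC.sum_left by (rule sum.swap)
      also have "\<dots> = \<Phi> c x"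
        by (simp add: \<Phi>_def c_def sum.cartesian_product blinfun.sum_left rank_one.rep_eq
            case_prod_beta scaleC_scaleC)
      finally show "Q x = \<Phi> c x" .
    qed
    ultimately show "Q \<in> \<Phi> ` K \<inter> {Q. is_proj Q \<and> E o\<^sub>L Q = Q}" using Q by blast
  next
    fix Q assume "Q \<in> \<Phi> ` K \<inter> {Q. is_proj Q \<and> E o\<^sub>L Q = Q}"
    then have Q: "is_proj Q" "E o\<^sub>L Q = Q" by auto
    have "range Q \<subseteq> cspan G"
      using Q(2) proj_onto_in_span[of G] unfolding G(3) by (metis blinfun_apply_blinfun_compose image_subsetI)
    then show "Q \<in> {Q \<in> Pc. E o\<^sub>L Q = Q}"
      using Q G(1) by (auto simp: Pc_def is_proj_def)
  qed
  ultimately show ?thesis by (simp add: compact_Int_closed)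
qed

text \<open>With the weights fixed, the integral of a bounded continuous function is a series that converges
  uniformly in the atoms, hence depends continuously on them in the product topology; the product of
  the \<open>S n\<close> is compact.\<close>

lemma compactin_dirac_sums:
  fixes S :: "nat \<Rightarrow> ('h::complex_hilbert_space \<Rightarrow>\<^sub>L 'h) set"
  assumes \<kappa>: "\<And>n. 0 \<le> \<kappa> n" "\<kappa> sums 1"
    and S: "\<And>n. compact (S n)" "\<And>n. S n \<subseteq> Pc"
  shows "compactin weak_topology (dirac_sum \<kappa> ` {T. \<forall>n. T n \<in> S n})"
proof -
  let ?X = "{T. \<forall>n. T n \<in> S n}"
  have X: "compact ?X" by (rule compact_Pi_UNIV[OF S(1)])
  have prob: "dirac_sum \<kappa> T \<in> prob_Pc" if "T \<in> ?X" for T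
    using that S(2) \<kappa> dirac_sum_in_prob_Pc_iff[of \<kappa> T] by auto
  have cont: "continuous_on ?X (\<lambda>T. \<integral>Q. f Q \<partial>dirac_sum \<kappa> T)"
    if f: "continuous_on Pc f" "bounded (f ` Pc)" for f :: "('h \<Rightarrow>\<^sub>L 'h) \<Rightarrow> real"
  proof -
    obtain K where K: "\<And>Q. Q \<in> Pc \<Longrightarrow> \<bar>f Q\<bar> \<le> K"
      using f(2) by (auto simp: bounded_iff)
    have "uniform_limit ?X (\<lambda>N T. \<Sum>n<N. \<kappa> n * f (T n)) (\<lambda>T. \<Sum>n. \<kappa> n * f (T n)) sequentially"
    proof (rule Weierstrass_m_test)
      show "summable (\<lambda>n. \<kappa> n * K)"
        using \<kappa>(2) by (intro summable_mult2) (rule sums_summable)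
      show "norm (\<kappa> n * f (T n)) \<le> \<kappa> n * K" if "T \<in> ?X" for n T
        using that S(2) K \<kappa>(1)[of n] by (auto simp: abs_mult intro!: mult_left_mono)
    qed
    moreover have "continuous_on ?X (\<lambda>T. \<Sum>n<N. \<kappa> n * f (T n))" for N
    proof (intro continuous_on_sum continuous_on_mult continuous_on_const)
      fix n
      show "continuous_on ?X (\<lambda>T. f (T n))"
        by (rule continuous_on_compose2[OF f(1)])
          (use S(2) in \<open>auto intro: continuous_on_subset[OF continuous_on_product_coordinates]\<close>)
    qed
    ultimately have "continuous_on ?X (\<lambda>T. \<Sum>n. \<kappa> n * f (T n))"
      by (intro uniform_limit_theorem) auto
    moreover have "(\<integral>Q. f Q \<partial>dirac_sum \<kappa> T) = (\<Sum>n. \<kappa> n * f (T n))" if "T \<in> ?X" for T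
      using integral_dirac_sum[OF \<kappa>, of T f K] that S(2) f(1) K
      by (auto intro: sums_unique)
    ultimately show ?thesis using continuous_on_cong[of ?X ?X] by (metis (no_types, lifting))
  qed
  have "continuous_map (top_of_set ?X) weak_topology (dirac_sum \<kappa>)"
    unfolding weak_topology_def
  proof (rule continuous_on_generated_topo)
    fix W :: "('h \<Rightarrow>\<^sub>L 'h) measure set"
    assume "W \<in> {{\<nu> \<in> prob_Pc. (\<integral>P. f P \<partial>\<nu>) \<in> U} |(f :: ('h \<Rightarrow>\<^sub>L 'h) \<Rightarrow> real) U.
      continuous_on Pc f \<and> bounded (f ` Pc) \<and> open U}"
    then obtain f :: "('h \<Rightarrow>\<^sub>L 'h) \<Rightarrow> real" and U where f: "W = {\<nu> \<in> prob_Pc. (\<integral>P. f P \<partial>\<nu>) \<in> U}" "continuous_on Pc f"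
      "bounded (f ` Pc)" "open U" by blast
    have "dirac_sum \<kappa> -` W \<inter> topspace (top_of_set ?X)
        = ?X \<inter> (\<lambda>T. \<integral>Q. f Q \<partial>dirac_sum \<kappa> T) -` U"
      using prob unfolding f(1) by auto
    then show "openin (top_of_set ?X) (dirac_sum \<kappa> -` W \<inter> topspace (top_of_set ?X))"
      using continuous_openin_preimage_gen[OF cont[OF f(2,3)] f(4)] by simp
  next
    have "prob_Pc \<in> {{\<nu> \<in> prob_Pc. (\<integral>P. f P \<partial>\<nu>) \<in> U} |(f :: ('h \<Rightarrow>\<^sub>L 'h) \<Rightarrow> real) U.
      continuous_on Pc f \<and> bounded (f ` Pc) \<and> open U}"
      by (intro CollectI exI[of _ "\<lambda>_. 0"] exI[of _ UNIV])
        (simp add: finite_imp_bounded image_constant_conv)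
    then show "dirac_sum \<kappa> ` topspace (top_of_set ?X) \<subseteq>
      \<Union> {{\<nu> \<in> prob_Pc. (\<integral>P. f P \<partial>\<nu>) \<in> U} |(f :: ('h \<Rightarrow>\<^sub>L 'h) \<Rightarrow> real) U.
        continuous_on Pc f \<and> bounded (f ` Pc) \<and> open U}"
      using prob by (intro subset_trans[OF _ Union_upper]) auto
  qed
  moreover have "compactin (top_of_set ?X) ?X"
    using X by (simp add: compactin_subtopology)
  ultimately show ?thesis by (rule image_compactin[rotated])
qed

text \<open>A nonempty set of decompositions provides one reference decomposition, whose positive unrolled
  weights list the positive eigenvalues of \<open>\<rho>\<close> with multiplicity. The positive unrolled weights of any other decomposition are
  a rearrangement of the same list, so after reindexing every element of the set is a sum of Dirac
  measures with the reference weights, whose \<open>n\<close>-th atom projects into the finite-dimensional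
  eigenspace of the \<open>n\<close>-th weight when that is positive.\<close>

lemma compactin_tr_Lambda_perp:
  fixes \<phi> :: "('h::complex_hilbert_space \<Rightarrow>\<^sub>L 'h) \<Rightarrow> complex"
  assumes sep: "separable_space (euclidean :: 'h topology)"
  shows "compactin weak_topology (tr_measure ` Lambda_perp \<phi>)"
proof (cases "tr_measure ` Lambda_perp \<phi> = {}")
  case True
  then show ?thesis by simp
next
  case False
  define \<rho> where "\<rho> = density_matrix \<phi>"
  obtain \<nu>0 where "\<nu>0 \<in> tr_measure ` Lambda_perp \<phi>" using False by blast
  then obtain w P where w: "orth_rep w P" "\<nu>0 = dirac_sum w P"
    "(\<lambda>i. (w i / rk (P i)) *\<^sub>R P i) sums \<rho>"
    unfolding \<rho>_def by (rule tr_Lambda_perp_orth_rep[OF sep])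
  define \<kappa> where "\<kappa> = unrolled w P"
  \<comment> \<open>The eigenspace of 0 may be infinite-dimensional, so indices of weight 0 get a fixed atom.\<close>
  define S where "S n = (if 0 < \<kappa> n then {Q \<in> Pc. \<forall>x. \<rho> (Q x) = \<kappa> n *\<^sub>R Q x} else {0})" for n
  have \<kappa>0: "0 \<le> \<kappa> n" for n unfolding \<kappa>_def by (rule unrolled_nonneg[OF w(1)])
  have \<kappa>1: "\<kappa> sums 1"
  proof -
    have "dirac_sum \<kappa> (\<lambda>n. P (fst (prod_decode n))) \<in> prob_Pc"
      unfolding \<kappa>_def dirac_sum_unrolled[OF w(1)]
      using w(1) dirac_sum_in_prob_Pc_iff[of w P] by (simp add: orth_rep_def)
    then show ?thesis
      using dirac_sum_in_prob_Pc_iff[of \<kappa> "\<lambda>n. P (fst (prod_decode n))"] \<kappa>0 w(1)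
      by (simp add: orth_rep_def)
  qed
  have S_Pc: "S n \<subseteq> Pc" for n using zero_in_Pc by (auto simp: S_def)
  have S_compact: "compact (S n)" for n
  proof (cases "0 < \<kappa> n")
    case True
    obtain E where E: "E \<in> Pc" "\<And>x. \<rho> x = \<kappa> n *\<^sub>R x \<longleftrightarrow> E x = x"
      using spectral_projection[OF w(1,3) True] by metis
    have "S n = {Q \<in> Pc. E o\<^sub>L Q = Q}"
      using True by (auto simp: S_def E(2) intro!: blinfun_eqI)
        (metis blinfun_apply_blinfun_compose)
    then show ?thesis using compact_subprojections[OF E(1)] by simp
  qed (simp add: S_def)
  have "tr_measure ` Lambda_perp \<phi> \<subseteq> dirac_sum \<kappa> ` {T. \<forall>n. T n \<in> S n}"
  proof
    fix \<nu> assume "\<nu> \<in> tr_measure ` Lambda_perp \<phi>"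
    then obtain w' P' where w': "orth_rep w' P'" "\<nu> = dirac_sum w' P'"
      "(\<lambda>i. (w' i / rk (P' i)) *\<^sub>R P' i) sums \<rho>"
      unfolding \<rho>_def by (rule tr_Lambda_perp_orth_rep[OF sep])
    define \<kappa>' where "\<kappa>' = unrolled w' P'"
    define T' where "T' n = P' (fst (prod_decode n))" for n
    have "finite {n. \<kappa> n = a} \<and> finite {n. \<kappa>' n = a} \<and> card {n. \<kappa> n = a} = card {n. \<kappa>' n = a}"
      if a: "0 < a" for a
    proof -
      obtain E where E: "E \<in> Pc" "\<And>x. \<rho> x = a *\<^sub>R x \<longleftrightarrow> E x = x"
        "finite {n. \<kappa> n = a}" "card {n. \<kappa> n = a} = rk E"
        by (rule spectral_projection[OF w(1,3) a, folded \<kappa>_def]) blast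
      obtain E' where E': "E' \<in> Pc" "\<And>x. \<rho> x = a *\<^sub>R x \<longleftrightarrow> E' x = x"
        "finite {n. \<kappa>' n = a}" "card {n. \<kappa>' n = a} = rk E'"
        by (rule spectral_projection[OF w'(1,3) a, folded \<kappa>'_def]) blast
      have "E = E'" using E(1,2) E'(1,2) by (intro Pc_eq_of_fixed_points) auto
      then show ?thesis using E E' by simp
    qed
    then obtain h where h: "bij_betw h {n. 0 < \<kappa> n} {n. 0 < \<kappa>' n}" "\<And>n. 0 < \<kappa> n \<Longrightarrow> \<kappa>' (h n) = \<kappa> n"
      using ex_bij_levels by metis
    define T where "T n = (if 0 < \<kappa> n then T' (h n) else 0)" for n
    have "\<nu> = dirac_sum \<kappa>' T'"
      unfolding w'(2) \<kappa>'_def T'_def by (rule dirac_sum_unrolled[OF w'(1), symmetric])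
    also have "\<dots> = dirac_sum \<kappa> (\<lambda>n. T' (h n))"
      by (rule dirac_sum_reindex[OF \<kappa>0 _ h]) (simp add: \<kappa>'_def unrolled_nonneg[OF w'(1)])
    also have "\<dots> = dirac_sum \<kappa> T"
      by (rule dirac_sum_cong[OF \<kappa>0]) (simp add: T_def)
    finally have "\<nu> = dirac_sum \<kappa> T" .
    moreover have "T n \<in> S n" for n
    proof (cases "0 < \<kappa> n")
      case True
      obtain i s where dec: "prod_decode (h n) = (i, s)" by (cases "prod_decode (h n)")
      have eq: "\<kappa> n = w' i / rk (P' i)"
        using h(2)[OF True] True dec by (auto simp: \<kappa>'_def unrolled_def split: if_splits)
      have "w' i \<noteq> 0" using eq True by auto
      then have "0 < w' i" using w'(1) by (auto simp: orth_rep_def less_le)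
      then have "\<rho> (P' i x) = \<kappa> n *\<^sub>R P' i x" for x
        using orth_rep_operator_atom(1)[OF w'(1,3)] eq by simp
      moreover have "P' i \<in> Pc" using w'(1) by (simp add: orth_rep_def)
      moreover have "T n = P' i" using True dec by (simp add: T_def T'_def)
      ultimately show ?thesis using True by (simp add: S_def)
    qed (simp add: T_def S_def)
    ultimately show "\<nu> \<in> dirac_sum \<kappa> ` {T. \<forall>n. T n \<in> S n}" by blast
  qed
  then show ?thesis
    by (rule closed_compactin[OF compactin_dirac_sums[OF \<kappa>0 \<kappa>1 S_compact S_Pc] _
          closedin_tr_Lambda_perp[OF sep]])
qed

theorem proposition3p5:
  assumes "separable_space (euclidean :: 'h::complex_hilbert_space topology)"
  shows "closedin weak_topology (tr_measure ` (D1_perp :: ('h \<Rightarrow>\<^sub>L 'h) measure set)) \<and>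
    (\<forall>\<phi> \<in> (normal_states :: (('h \<Rightarrow>\<^sub>L 'h) \<Rightarrow> complex) set).
       compactin weak_topology (tr_measure ` Lambda_perp \<phi>))"
  using closedin_tr_D1_perp[OF assms] compactin_tr_Lambda_perp[OF assms] by blast


end
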